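(* Let $\alpha\in(0,1)$. Let $\mathbb{L}_1$ be the reinforced loop soup with parameter $1$ on $\widetilde V$, and construct $\mathbb{L}'_\alpha$ by keeping each loop of $\mathbb{L}_1$ with probability $\alpha$ and discarding it with probability $1-\alpha$, independently of all other loops of $\mathbb{L}_1$. Then the law of $\mathbb{L}'_\alpha$ is that of the reinforced loop soup $\mathbb{L}_\alpha$, i.e. the annealed Poissonian loop soup of parameter $\alpha$: $$\mathrm{Law}(\mathbb{L}'_\alpha)=\int_{\mathbb{R}^{|V|}}\mathrm{Law}\big(\mathcal{L}^{\widetilde{\mathbf u}}_\alpha\big)\,d\nu_\delta^{\widetilde W,\mathbf 1}(\widetilde{\mathbf u}).$$
   Context: **Graph.** $\widetilde V=V\cup\{\delta\}$ is a finite connected graph with symmetric weights $\widetilde W_{ij}=\widetilde W_{ji}\ge0$, $\widetilde W_{ii}=0$ (weight $0$ means no edge), edge set $E(\widetilde V)$. **Poissonian loop soup.** For a jump process on $V$ with rates $q_{ij}$ ($i\neq j\in V$) and total holding rate $q_i$ at $i$ (including killing), a based loop of duration $t$ at $i$ is a piecewise constant trajectory on $[0,t]$ starting and ending at $i$, jumping at times $0<t_1<\dots<t_k<t$ through $i\to i_1\to\dots\to i_{k-1}\to i$ (the trivial loop, with no jump, is allowed). Let $P_t^{(i,i)}(dl)=q_{ii_1}q_{i_1i_2}\cdots q_{i_{k-1}i}\,e^{-t_1q_i-(t_2-t_1)q_{i_1}-\dots-(t-t_k)q_i}dt_1\cdots dt_k$ and $\mu(dl)=\sum_{i\in V}\int_0^\infty\frac1tP_t^{(i,i)}(dl)\,dt$.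 Unbased loops are equivalence classes of based loops under rerooting and $\mu^\circ$ is the image of $\mu$. $\mathcal L_\alpha$ is the Poisson point process of unbased loops with intensity $\alpha\mu^\circ$. For $\widetilde{\mathbf u}\in\mathbb{R}^{\widetilde V}$ with $u_\delta=0$, $\mathcal L_\alpha^{\widetilde{\mathbf u}}$ is the case $q_{ij}=\frac12\widetilde W_{ij}e^{u_j-u_i}$, $q_i=\sum_{k\in\widetilde V}\frac12\widetilde W_{ik}e^{u_k-u_i}$ (the Markov jump process with rates $\frac12\widetilde W_{ij}e^{u_j-u_i}$ on $\widetilde V$ killed at $\delta$). **Mixing measure.** On $\widetilde{\mathbf u}=(u_i)_{i\in\widetilde V}$ with $u_\delta=0$: $$d\nu_\delta^{\widetilde W,\mathbf 1}(\widetilde{\mathbf u})=\mathbf 1_{\{u_\delta=0\}}e^{-\frac12\sum_{(ij)\in E(\widetilde V)}\widetilde W_{ij}(e^{u_i-u_j}+e^{u_j-u_i}-2)}\sqrt{D(\widetilde W,\widetilde{\mathbf u})}\prod_{i\in V}\frac{e^{-u_i}du_i}{\sqrt{2\pi}},\quad D(\widetilde W,\widetilde{\mathbf u})=\sum_T\prod_{(ij)\in E(T)}\widetilde W_{ij}e^{u_i+u_j},$$ sum over spanning trees $T$ of $\widetilde V$. It is a probability measure. **Reinforced loop soup $\mathbb{L}_1$ (initial local times $\mathbf 1$).** The random collection of unbased loops whose law is the annealed law $\int\mathrm{Law}(\mathcal L_1^{\widetilde{\mathbf u}})\,d\nu_\delta^{\widetilde W,\mathbf 1}(\widetilde{\mathbf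 u})$; the paper realizes it by the reinforced Wilson's algorithm, regrouping the erased loops into large loops and applying independent Poisson–Dirichlet$(0,1)$ decompositions. More generally, the reinforced loop soup $\mathbb{L}_\alpha$ is the random collection of unbased loops with law $\int\mathrm{Law}(\mathcal L_\alpha^{\widetilde{\mathbf u}})\,d\nu_\delta^{\widetilde W,\mathbf 1}(\widetilde{\mathbf u})$. *)

theory Defs
  imports "HOL-Probability.Probability"
begin

section \<open>Weighted graphs and spanning trees\<close>

text \<open>
  The vertex set of the graph is the whole finite type, edges are two-element sets of
  vertices. The spanning trees of \<open>Graph_Theory\<close> are not used, since that library
  excludes only directed cycles.
\<close>

definition edges :: "('v \<Rightarrow> 'v \<Rightarrow> real) \<Rightarrow> 'v set set" where
  "edges W = {{i, j} | i j. 0 < W i j}"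

definition connects :: "'v set set \<Rightarrow> bool" where
  "connects T \<longleftrightarrow> (\<forall>i j. (i, j) \<in> {(a, b). {a, b} \<in> T}\<^sup>*)"

definition has_cycle :: "'v set set \<Rightarrow> bool" where
  "has_cycle T \<longleftrightarrow> (\<exists>p. 3 \<le> length p \<and> distinct p \<and>
     (\<forall>n<length p. {p ! n, p ! (Suc n mod length p)} \<in> T))"

definition spanning_trees :: "('v \<Rightarrow> 'v \<Rightarrow> real) \<Rightarrow> 'v set set set" where
  "spanning_trees W = {T. T \<subseteq> edges W \<and> connects T \<and> \<not> has_cycle T}"

text \<open>Value of a symmetric function of two vertices on an undirected edge.\<close>

definition edge_val :: "('v \<Rightarrow> 'v \<Rightarrow> real) \<Rightarrow> 'v set \<Rightarrow> real" where
  "edge_val f e = (THE x. \<exists>i j. e = {i, j} \<and> x = f i j)"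

lemma edge_val_eq:
  assumes "\<And>i j. f i j = f j i"
  shows "edge_val f {i, j} = f i j"
  unfolding edge_val_def
  by (rule the_equality) (use assms in \<open>auto simp: doubleton_eq_iff\<close>)

section \<open>The mixing measure\<close>

definition tree_sum :: "('v \<Rightarrow> 'v \<Rightarrow> real) \<Rightarrow> ('v \<Rightarrow> real) \<Rightarrow> real" where
  "tree_sum W u =
     (\<Sum>T\<in>spanning_trees W. \<Prod>e\<in>T. edge_val (\<lambda>i j. W i j * exp (u i + u j)) e)"

text \<open>The Dirac factor at \<open>\<delta>\<close> implements the constraint \<open>u \<delta> = 0\<close>.\<close>

definition mixing_measure ::
    "('v::finite \<Rightarrow> 'v \<Rightarrow> real) \<Rightarrow> 'v \<Rightarrow> ('v \<Rightarrow> real) measure" where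
  "mixing_measure W \<delta> =
     density (\<Pi>\<^sub>M i\<in>UNIV. if i = \<delta> then return borel 0 else lborel)
       (\<lambda>u. ennreal
         (exp (- (1/2) * (\<Sum>e\<in>edges W.
              edge_val (\<lambda>i j. W i j * (exp (u i - u j) + exp (u j - u i) - 2)) e))
          * sqrt (tree_sum W u)
          * (\<Prod>i\<in>-{\<delta>}. exp (- u i) / sqrt (2 * pi))))"

section \<open>Based and unbased loops\<close>

text \<open>
  A based loop is a pair of its duration \<open>t\<close> and its trajectory on \<open>{0..t}\<close>, extended by
  \<open>undefined\<close> outside of \<open>{0..t}\<close>.
\<close>

type_synonym 'v based_loop = "real \<times> (real \<Rightarrow> 'v)"

text \<open>
  The trajectory of duration \<open>t\<close> through the vertices \<open>x 0, \<dots>, x k\<close> with jump times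
  \<open>\<tau> 1 < \<dots> < \<tau> k\<close>.
\<close>

definition trajectory ::
    "real \<Rightarrow> nat \<Rightarrow> (nat \<Rightarrow> 'v) \<Rightarrow> (nat \<Rightarrow> real) \<Rightarrow> 'v based_loop" where
  "trajectory t k x \<tau> = (t, \<lambda>r\<in>{0..t}. x (card {j\<in>{1..k}. \<tau> j \<le> r}))"

definition closed_paths :: "'v set \<Rightarrow> 'v \<Rightarrow> nat \<Rightarrow> (nat \<Rightarrow> 'v) set" where
  "closed_paths V i k =
     {x \<in> {0..k} \<rightarrow>\<^sub>E V. x 0 = i \<and> x k = i \<and> (\<forall>j<k. x j \<noteq> x (Suc j))}"

definition jump_times :: "real \<Rightarrow> nat \<Rightarrow> (nat \<Rightarrow> real) set" where
  "jump_times t k = {\<tau>. strict_mono_on {1..k} \<tau> \<and> (\<forall>j\<in>{1..k}. 0 < \<tau> j \<and> \<tau> j < t)}"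

definition based_loop_set :: "'v set \<Rightarrow> 'v based_loop set" where
  "based_loop_set V =
     {trajectory t k x \<tau> | t k x \<tau> i.
        0 < t \<and> i \<in> V \<and> x \<in> closed_paths V i k \<and> \<tau> \<in> jump_times t k}"

definition based_loops :: "'v set \<Rightarrow> 'v based_loop measure" where
  "based_loops V =
     restrict_space (borel \<Otimes>\<^sub>M (\<Pi>\<^sub>M r\<in>UNIV. count_space UNIV)) (based_loop_set V)"

definition reroot :: "real \<Rightarrow> 'v based_loop \<Rightarrow> 'v based_loop" where
  "reroot s l = (case l of (t, f) \<Rightarrow>
     (t, \<lambda>r\<in>{0..t}. if r + s \<le> t then f (r + s) else f (r + s - t)))"

definition reroot_rel :: "'v set \<Rightarrow> ('v based_loop \<times> 'v based_loop) set" where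
  "reroot_rel V = {(l, l'). l \<in> based_loop_set V \<and> l' \<in> based_loop_set V \<and>
     (\<exists>s. 0 \<le> s \<and> s < fst l \<and> l' = reroot s l)}"

type_synonym 'v loop = "'v based_loop set"

definition loop_of :: "'v set \<Rightarrow> 'v based_loop \<Rightarrow> 'v loop" where
  "loop_of V l = reroot_rel V `` {l}"

text \<open>The unbased loops carry the quotient \<open>\<sigma>\<close>-algebra.\<close>

definition loops :: "'v set \<Rightarrow> 'v loop measure" where
  "loops V = sigma (based_loop_set V // reroot_rel V)
     {A. A \<subseteq> based_loop_set V // reroot_rel V \<and>
         loop_of V -` A \<inter> based_loop_set V \<in> sets (based_loops V)}"

section \<open>The loop measure\<close>

text \<open>
  \<open>q i j\<close> are the jump rates and \<open>h i\<close> the total holding rates (including killing). The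
  jump times are completed by \<open>0\<close> and \<open>t\<close>.
\<close>

definition loop_density ::
    "('v \<Rightarrow> 'v \<Rightarrow> real) \<Rightarrow> ('v \<Rightarrow> real) \<Rightarrow> real \<Rightarrow> nat \<Rightarrow> (nat \<Rightarrow> 'v) \<Rightarrow> (nat \<Rightarrow> real) \<Rightarrow> real"
    where
  "loop_density q h t k x \<tau> =
     (\<Prod>j<k. q (x j) (x (Suc j))) *
     exp (- (\<Sum>j\<le>k. ((if j = k then t else \<tau> (Suc j)) - (if j = 0 then 0 else \<tau> j)) * h (x j)))"

definition based_loop_measure_at ::
    "'v set \<Rightarrow> ('v \<Rightarrow> 'v \<Rightarrow> real) \<Rightarrow> ('v \<Rightarrow> real) \<Rightarrow> 'v \<Rightarrow> real \<Rightarrow> 'v based_loop measure" where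
  "based_loop_measure_at V q h i t =
     measure_of (space (based_loops V)) (sets (based_loops V))
       (\<lambda>A. \<Sum>k. \<Sum>x\<in>closed_paths V i k.
          \<integral>\<^sup>+\<tau>\<in>jump_times t k. ennreal (loop_density q h t k x \<tau>) * indicator A (trajectory t k x \<tau>)
            \<partial>(\<Pi>\<^sub>M j\<in>{1..k}. lborel))"

definition based_loop_measure ::
    "'v set \<Rightarrow> ('v \<Rightarrow> 'v \<Rightarrow> real) \<Rightarrow> ('v \<Rightarrow> real) \<Rightarrow> 'v based_loop measure" where
  "based_loop_measure V q h =
     measure_of (space (based_loops V)) (sets (based_loops V))
       (\<lambda>A. \<Sum>i\<in>V. \<integral>\<^sup>+t\<in>{0<..}. ennreal (1 / t) * emeasure (based_loop_measure_at V q h i t) A \<partial>lborel)"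

definition loop_measure ::
    "'v set \<Rightarrow> ('v \<Rightarrow> 'v \<Rightarrow> real) \<Rightarrow> ('v \<Rightarrow> real) \<Rightarrow> 'v loop measure" where
  "loop_measure V q h = distr (based_loop_measure V q h) (loops V) (loop_of V)"

section \<open>Random collections, Poisson point processes and thinning\<close>

text \<open>
  A collection of points of \<open>M\<close> is a countable multiset, given by its multiplicities. The
  \<open>\<sigma>\<close>-algebra is generated by the numbers of points in the measurable sets.
\<close>

definition num_points :: "('a \<Rightarrow> enat) \<Rightarrow> 'a set \<Rightarrow> ennreal" where
  "num_points c A = (\<integral>\<^sup>+a. ennreal_of_enat (c a) \<partial>count_space A)"

definition collection_set :: "'a measure \<Rightarrow> ('a \<Rightarrow> enat) set" where
  "collection_set M = {c. countable {a. c a \<noteq> 0} \<and> {a. c a \<noteq> 0} \<subseteq> space M}"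

definition collections :: "'a measure \<Rightarrow> ('a \<Rightarrow> enat) measure" where
  "collections M =
     (SUP A\<in>sets M. vimage_algebra (collection_set M) (\<lambda>c. num_points c A) borel)"

definition is_poisson_process_law :: "'a measure \<Rightarrow> ('a \<Rightarrow> enat) measure \<Rightarrow> bool" where
  "is_poisson_process_law M P \<longleftrightarrow>
     prob_space P \<and> sets P = sets (collections M) \<and>
     (\<forall>A\<in>sets M. emeasure M A < \<infinity> \<longrightarrow>
        (\<forall>n::nat. measure P {c\<in>space P. num_points c A = of_nat n} =
           measure M A ^ n / fact n * exp (- measure M A))) \<and>
     (\<forall>A\<in>sets M. emeasure M A = \<infinity> \<longrightarrow> (AE c in P. num_points c A = \<infinity>)) \<and>
     (\<forall>A::nat \<Rightarrow> 'a set. range A \<subseteq> sets M \<longrightarrow> disjoint_family A \<longrightarrow>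
        prob_space.indep_vars P (\<lambda>_. borel) (\<lambda>n c. num_points c (A n)) UNIV)"

definition poisson_process_law :: "'a measure \<Rightarrow> ('a \<Rightarrow> enat) measure" where
  "poisson_process_law M = (THE P. is_poisson_process_law M P)"

text \<open>
  Independent thinning, as a probability kernel: the copies \<open>(a, n)\<close>, \<open>n < c a\<close>, of the
  points of the collection \<open>c\<close> carry independent Bernoulli marks of parameter \<open>p\<close>, and
  only the copies marked \<open>True\<close> are kept.
\<close>

definition copies :: "('a \<Rightarrow> enat) \<Rightarrow> ('a \<times> nat) set" where
  "copies c = {(a, n). enat n < c a}"

definition kept :: "('a \<Rightarrow> enat) \<Rightarrow> ('a \<times> nat \<Rightarrow> bool) \<Rightarrow> 'a \<Rightarrow> enat" where
  "kept c b a = (let S = {n. (a, n) \<in> copies c \<and> b (a, n)}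
                 in if finite S then enat (card S) else \<infinity>)"

definition thinning :: "'a measure \<Rightarrow> real \<Rightarrow> ('a \<Rightarrow> enat) \<Rightarrow> ('a \<Rightarrow> enat) measure" where
  "thinning M p c =
     distr (\<Pi>\<^sub>M _\<in>copies c. measure_pmf (bernoulli_pmf p)) (collections M) (kept c)"

section \<open>Poissonian and reinforced loop soups\<close>

definition loop_soup ::
    "('v::finite \<Rightarrow> 'v \<Rightarrow> real) \<Rightarrow> 'v \<Rightarrow> real \<Rightarrow> ('v \<Rightarrow> real) \<Rightarrow> ('v loop \<Rightarrow> enat) measure" where
  "loop_soup W \<delta> \<alpha> u =
     poisson_process_law (scale_measure (ennreal \<alpha>)
       (loop_measure (-{\<delta>})
          (\<lambda>i j. 1/2 * W i j * exp (u j - u i))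
          (\<lambda>i. \<Sum>k\<in>UNIV. 1/2 * W i k * exp (u k - u i))))"

definition reinforced_loop_soup ::
    "('v::finite \<Rightarrow> 'v \<Rightarrow> real) \<Rightarrow> 'v \<Rightarrow> real \<Rightarrow> ('v loop \<Rightarrow> enat) measure" where
  "reinforced_loop_soup W \<delta> \<alpha> = mixing_measure W \<delta> \<bind> loop_soup W \<delta> \<alpha>"

end

theory Submission
  imports Defs
begin

text \<open>
  Conditionally on the mixing field \<open>u\<close> the loop soup is a Poisson process of loops, and the independent thinning
  with retention probability \<open>\<alpha>\<close> of a Poisson process with intensity \<open>\<mu>\<close> is a Poisson process with intensity
  \<open>\<alpha> \<mu>\<close> (\<open>thinning_poisson_process_law\<close>). So the identity holds for every fixed \<open>u\<close>, and integrating over \<open>u\<close> gives the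
  annealed statement. The integration is associativity of the composition of kernels, which needs that
  \<open>u \<mapsto> loop_soup W \<delta> \<alpha> u\<close> (\<open>measurable_loop_soup\<close>) and \<open>c \<mapsto> thinning M \<alpha> c\<close> (\<open>measurable_thinning\<close>) are measurable.

  Poisson processes are handled through their Laplace functional
  \<open>E (exp (- \<Sum>i. t i * N (B i))) = exp (- \<Sum>i. (1 - exp (- t i)) * \<mu> (B i))\<close> for disjoint \<open>B i\<close>, where \<open>N\<close> counts points.
  Joint laws of \<open>enat\<close>-valued counts are determined by it through uniqueness of power series coefficients
  (\<open>laplace_unique\<close>), and the law of a random collection is determined by the joint laws of its counts in
  finitely many disjoint sets (\<open>collections_measure_eqI\<close>). This gives uniqueness of the Poisson process and
  its independence properties. Existence holds for every countable sum of finite measures: a finite measure is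
  realised by a Poisson number of independent points, and the pieces are superposed
  (\<open>has_poisson_laplace_poisson_process_law\<close>). In the Laplace functional, thinning
  replaces \<open>exp (- t)\<close> by \<open>\<alpha> * exp (- t) + 1 - \<alpha>\<close>, hence \<open>1 - exp (- t)\<close> by \<open>\<alpha> * (1 - exp (- t))\<close>, which is the
  thinning theorem.

  Finally, the loop measure is the sum, over the countably many discrete closed paths, of images of
  sigma-finite measures with densities on the space of durations and jump times
  (\<open>emeasure_loop_measure\<close>); this yields both its s-finiteness and its measurable dependence on \<open>u\<close>.
\<close>

section \<open>The function \<open>exp (- x)\<close> on the extended nonnegative reals\<close>

text \<open>
  The decreasing exponential \<open>exp (- x)\<close> with \<open>exp (- \<infinity>) = 0\<close>. Since \<open>\<infinity> * 0 = 0\<close>, the function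
  \<open>t \<mapsto> nexp (t * n)\<close> covers all powers \<open>s ^ n\<close> with \<open>0 \<le> s \<le> 1\<close>, including \<open>s = 0\<close>, and is meaningful for
  infinite \<open>n\<close>. Laplace functionals are expectations of \<open>nexp\<close> of a linear combination of counts.
\<close>

definition nexp :: "ennreal \<Rightarrow> ennreal" where
  "nexp x = (if x = \<infinity> then 0 else ennreal (exp (- enn2real x)))"

lemma nexp_0 [simp]: "nexp 0 = 1"
  by (simp add: nexp_def)

lemma nexp_infinity [simp]: "nexp \<infinity> = 0" "nexp top = 0"
  by (simp_all add: nexp_def)

lemma nexp_ennreal: "0 \<le> x \<Longrightarrow> nexp (ennreal x) = ennreal (exp (- x))"
  by (simp add: nexp_def)

lemma nexp_le_1: "nexp x \<le> 1"
  by (simp add: nexp_def)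

lemma nexp_less_top [simp]: "nexp x < \<infinity>" "nexp x < top"
  by (simp_all add: nexp_def)

lemma nexp_add: "nexp (x + y) = nexp x * nexp y"
  by (cases x; cases y)
     (auto simp: nexp_ennreal mult_exp_exp ennreal_mult[symmetric] ennreal_plus[symmetric]
           simp del: ennreal_plus)

lemma nexp_sum: "nexp (sum f A) = (\<Prod>x\<in>A. nexp (f x))"
  by (induction A rule: infinite_finite_induct) (auto simp: nexp_add)

lemma nexp_antimono: "x \<le> y \<Longrightarrow> nexp y \<le> nexp x"
  by (cases x; cases y) (auto simp: nexp_ennreal top_unique)

lemma borel_measurable_nexp [measurable]: "nexp \<in> borel_measurable borel"
  unfolding nexp_def by measurable

lemma nexp_surj:
  assumes "r \<le> 1"
  obtains t where "nexp t = r"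
proof (cases r)
  case (real x)
  with assms have x: "0 \<le> x" "x \<le> 1"
    by simp_all
  show thesis
  proof (cases "x = 0")
    case True
    with real show thesis by (intro that[of \<infinity>]) simp
  next
    case False
    with x have "ln x \<le> 0" by simp
    with False x real show thesis
      by (intro that[of "ennreal (- ln x)"]) (simp add: nexp_ennreal)
  qed
qed (use assms in \<open>simp add: top_unique\<close>)

lemma nexp_SUP:
  assumes "incseq x"
  shows "nexp (SUP n. x n) = (INF n::nat. nexp (x n))"
proof (cases "(SUP n. x n) = \<infinity>")
  case True
  have "(INF n. nexp (x n)) \<le> ennreal (exp (- real k))" for k
  proof -
    have "of_nat k < (SUP n. x n)" unfolding True by (simp add: of_nat_less_top)
    then obtain n where "of_nat k < x n" by (auto simp: less_SUP_iff)
    then have "nexp (x n) \<le> nexp (of_nat k)" by (intro nexp_antimono) simp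
    also have "\<dots> = ennreal (exp (- real k))"
      by (simp add: nexp_ennreal ennreal_of_nat_eq_real_of_nat)
    finally show ?thesis by (meson INF_lower2 UNIV_I)
  qed
  moreover have "(\<lambda>k. ennreal (exp (- real k))) \<longlonglongrightarrow> ennreal 0"
    by (intro tendsto_ennrealI filterlim_compose[OF exp_at_bot]
        filterlim_compose[OF filterlim_uminus_at_bot_at_top filterlim_real_sequentially])
  ultimately have "(INF n. nexp (x n)) \<le> ennreal 0"
    by (intro LIMSEQ_le_const) auto
  then show ?thesis unfolding True by simp
next
  case False
  have le: "x n \<le> (SUP n. x n)" for n by (rule SUP_upper) simp
  with False have fin: "x n \<noteq> \<infinity>" for n by (metis infinity_ennreal_def neq_top_trans)
  have "(\<lambda>n. enn2real (x n)) \<longlonglongrightarrow> enn2real (SUP n. x n)"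
  proof (rule tendsto_enn2real)
    show "x \<longlonglongrightarrow> ennreal (enn2real (SUP n. x n))"
      using LIMSEQ_SUP[OF assms] False
      by (subst ennreal_enn2real) (simp_all add: less_top[symmetric] del: SUP_eq_top_iff)
  qed simp
  then have "(\<lambda>n. ennreal (exp (- enn2real (x n)))) \<longlonglongrightarrow> ennreal (exp (- enn2real (SUP n. x n)))"
    by (intro tendsto_ennrealI tendsto_exp tendsto_minus)
  then have "(\<lambda>n. nexp (x n)) \<longlonglongrightarrow> nexp (SUP n. x n)"
    by (simp only: nexp_def False fin if_False)
  moreover have "(\<lambda>n. nexp (x n)) \<longlonglongrightarrow> (INF n. nexp (x n))"
    using assms by (intro LIMSEQ_INF) (auto simp: decseq_def incseq_def intro: nexp_antimono)
  ultimately show ?thesis by (rule LIMSEQ_unique)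
qed

section \<open>Laplace transforms of random vectors with values in the extended naturals\<close>

lemma powser_coeffs_unique:
  fixes a b :: "nat \<Rightarrow> real"
  assumes a: "\<And>s. 0 < s \<Longrightarrow> s < 1 \<Longrightarrow> (\<lambda>n. a n * s ^ n) sums f s"
    and b: "\<And>s. 0 < s \<Longrightarrow> s < 1 \<Longrightarrow> (\<lambda>n. b n * s ^ n) sums f s"
  shows "a n = b n"
proof (induction n rule: less_induct)
  case (less n)
  define c where "c j = a (j + n) - b (j + n)" for j
  have sums: "(\<lambda>j. c j * s ^ j) sums 0" if s: "0 < s" "s < 1" for s
  proof -
    have "(\<lambda>j. a j * s ^ j - b j * s ^ j) sums 0"
      using sums_diff[OF a[OF s] b[OF s]] by simp
    then have "(\<lambda>j. a (j + n) * s ^ (j + n) - b (j + n) * s ^ (j + n)) sums 0"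
      using less by (subst sums_iff_shift) simp
    then have "(\<lambda>j. (a (j + n) * s ^ (j + n) - b (j + n) * s ^ (j + n)) / s ^ n) sums (0 / s ^ n)"
      by (rule sums_divide)
    then show ?thesis
      using s by (simp add: c_def power_add left_diff_distrib[symmetric])
  qed
  \<comment> \<open>The first coefficient not yet known to agree is the limit at \<open>0\<close> of a series that vanishes on \<open>(0, 1)\<close>.\<close>
  have "((\<lambda>x. \<Sum>j. c j * x ^ j) \<longlongrightarrow> c 0) (at 0)"
  proof (rule powser_limit_0[where s = 1])
    fix x :: real assume x: "norm x < 1"
    then obtain s where s: "norm x < s" "s < 1" using dense by blast
    then have "0 < s" using norm_ge_zero[of x] by linarith
    with s have "summable (\<lambda>j. c j * x ^ j)"
      by (intro powser_inside[of c s x]) (use sums[of s] in \<open>auto simp: sums_iff\<close>)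
    then show "(\<lambda>j. c j * x ^ j) sums (\<Sum>j. c j * x ^ j)" by (rule summable_sums)
  qed simp
  then have "((\<lambda>x. \<Sum>j. c j * x ^ j) \<longlongrightarrow> c 0) (at_right 0)"
    by (rule filterlim_mono) (simp_all add: at_le)
  moreover have "((\<lambda>x. \<Sum>j. c j * x ^ j) \<longlongrightarrow> 0) (at_right 0)"
  proof (rule tendsto_eventually)
    show "\<forall>\<^sub>F x in at_right 0. (\<Sum>j. c j * x ^ j) = 0"
      using eventually_at_right_real[of 0 1]
      by (rule eventually_mono) (use sums in \<open>auto simp: sums_iff\<close>)
  qed
  ultimately have "c 0 = 0"
    by (intro tendsto_unique[of "at_right 0"]) auto
  then show ?case by (simp add: c_def)
qed

lemma nn_integral_nexp_enat:
  fixes \<rho> :: "enat measure"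
  assumes sets [measurable_cong]: "sets \<rho> = UNIV" and s: "0 < s" "s < 1"
  shows "(\<integral>\<^sup>+x. nexp (ennreal (- ln s) * ennreal_of_enat x) \<partial>\<rho>)
       = (\<Sum>n. ennreal (s ^ n) * emeasure \<rho> {enat n})"
proof -
  have s': "0 \<le> - ln s" "- ln s > 0" using s by auto
  have "nexp (ennreal (- ln s) * ennreal_of_enat x)
      = (\<Sum>n. ennreal (s ^ n) * indicator {enat n} x)" for x
  proof (cases x)
    case (enat k)
    have "(\<Sum>n. ennreal (s ^ n) * indicator {enat n} x) = (\<Sum>n\<in>{k}. ennreal (s ^ n) * indicator {enat n} x)"
      by (intro suminf_finite) (auto simp: enat)
    moreover have "exp (- (- ln s * real k)) = s ^ k"
      using s by (simp add: exp_of_nat2_mult)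
    moreover have "ennreal (- ln s) * ennreal_of_enat x = ennreal (- ln s * real k)"
      using s' by (subst ennreal_mult) (auto simp: enat ennreal_of_nat_eq_real_of_nat)
    moreover have "0 \<le> - ln s * real k"
      using s' by (intro mult_nonneg_nonneg) auto
    ultimately show ?thesis
      using enat by (simp add: nexp_ennreal del: mult_minus_left)
  next
    case infinity
    then show ?thesis using s' by (simp add: ennreal_mult_top ennreal_eq_0_iff)
  qed
  moreover have [measurable]: "g \<in> borel_measurable \<rho>" for g :: "enat \<Rightarrow> ennreal"
    using sets by (simp add: measurable_def)
  ultimately show ?thesis
    by (simp add: nn_integral_suminf nn_integral_cmult_indicator sets)
qed

lemma sums_measure_enat:
  fixes \<tau> :: "enat measure"
  assumes \<tau>: "finite_measure \<tau>" "sets \<tau> = UNIV" and s: "0 < s" "s < 1"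
  shows "(\<lambda>n. measure \<tau> {enat n} * s ^ n) sums
    enn2real (\<integral>\<^sup>+x. nexp (ennreal (- ln s) * ennreal_of_enat x) \<partial>\<tau>)"
proof -
  interpret \<tau>: finite_measure \<tau> by fact
  have eq: "(\<integral>\<^sup>+x. nexp (ennreal (- ln s) * ennreal_of_enat x) \<partial>\<tau>) = (\<Sum>n. ennreal (measure \<tau> {enat n} * s ^ n))"
    unfolding nn_integral_nexp_enat[OF \<tau>(2) s]
    using s by (simp add: \<tau>.emeasure_eq_measure ennreal_mult mult.commute)
  have "(\<integral>\<^sup>+x. nexp (ennreal (- ln s) * ennreal_of_enat x) \<partial>\<tau>) \<le> (\<integral>\<^sup>+x. 1 \<partial>\<tau>)"
    by (intro nn_integral_mono nexp_le_1)
  also have "\<dots> < top" by (simp add: less_top[symmetric])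
  finally have "(\<Sum>n. ennreal (measure \<tau> {enat n} * s ^ n)) \<noteq> top"
    unfolding eq by simp
  then have "summable (\<lambda>n. measure \<tau> {enat n} * s ^ n)"
    using s by (intro summable_suminf_not_top) auto
  with s show ?thesis
    unfolding eq by (subst suminf_ennreal2) (auto simp: suminf_nonneg intro!: summable_sums)
qed

lemma emeasure_UNIV_enat:
  fixes \<tau> :: "enat measure"
  assumes sets: "sets \<tau> = UNIV"
  shows "emeasure \<tau> UNIV = emeasure \<tau> {\<infinity>} + (\<Sum>n. emeasure \<tau> {enat n})"
proof -
  have "UNIV = {\<infinity>} \<union> (\<Union>n. {enat n})" by (auto simp: not_infinity_eq)
  then have "emeasure \<tau> UNIV = emeasure \<tau> ({\<infinity>} \<union> (\<Union>n. {enat n}))" by simp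
  also have "\<dots> = emeasure \<tau> {\<infinity>} + emeasure \<tau> (\<Union>n. {enat n})"
    by (intro plus_emeasure[symmetric]) (auto simp: sets)
  also have "emeasure \<tau> (\<Union>n. {enat n}) = (\<Sum>n. emeasure \<tau> {enat n})"
    by (intro suminf_emeasure[symmetric]) (auto simp: sets disjoint_family_on_def)
  finally show ?thesis .
qed

text \<open>
  The values at \<open>t = - ln s\<close> form a power series in \<open>s\<close> whose coefficients are the masses of the finite points;
  the value at \<open>t = 0\<close> is the total mass and yields the mass of \<open>\<infinity>\<close>.
\<close>

lemma laplace_unique_enat:
  fixes \<rho> \<sigma> :: "enat measure"
  assumes fin: "finite_measure \<rho>" "finite_measure \<sigma>"
    and sets: "sets \<rho> = UNIV" "sets \<sigma> = UNIV"
    and eq: "\<And>t. (\<integral>\<^sup>+x. nexp (t * ennreal_of_enat x) \<partial>\<rho>) = (\<integral>\<^sup>+x. nexp (t * ennreal_of_enat x) \<partial>\<sigma>)"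
  shows "emeasure \<rho> {m} = emeasure \<sigma> {m}"
proof -
  interpret \<rho>: finite_measure \<rho> by fact
  interpret \<sigma>: finite_measure \<sigma> by fact
  have fin_eq: "emeasure \<rho> {enat n} = emeasure \<sigma> {enat n}" for n
  proof -
    have "measure \<rho> {enat n} = measure \<sigma> {enat n}"
      by (rule powser_coeffs_unique[where f = "\<lambda>s. enn2real (\<integral>\<^sup>+x. nexp (ennreal (- ln s) * ennreal_of_enat x) \<partial>\<rho>)"])
         (use sums_measure_enat[OF fin(1) sets(1)] sums_measure_enat[OF fin(2) sets(2)] eq in auto)
    then show ?thesis by (simp add: \<rho>.emeasure_eq_measure \<sigma>.emeasure_eq_measure)
  qed
  show ?thesis
  proof (cases m)
    case (enat n)
    with fin_eq show ?thesis by simp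
  next
    case infinity
    have "emeasure \<rho> UNIV = emeasure \<sigma> UNIV"
    proof -
      have "space \<rho> = UNIV" "space \<sigma> = UNIV"
        using sets sets.sets_into_space by blast+
      with eq[of 0] show ?thesis by simp
    qed
    then have "emeasure \<rho> {\<infinity>} + (\<Sum>n. emeasure \<rho> {enat n}) = emeasure \<sigma> {\<infinity>} + (\<Sum>n. emeasure \<rho> {enat n})"
      using emeasure_UNIV_enat[OF sets(1)] emeasure_UNIV_enat[OF sets(2)] fin_eq by simp
    moreover have "(\<Sum>n. emeasure \<rho> {enat n}) \<noteq> top"
      using emeasure_UNIV_enat[OF sets(1)] \<rho>.emeasure_finite[of UNIV] by (auto simp: top_unique)
    ultimately show ?thesis
      using infinity by (metis ennreal_add_left_cancel add.commute infinity_ennreal_def)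
  qed
qed

text \<open>
  Finite-dimensional distributions of \<open>enat\<close>-valued variables are determined by their joint Laplace transform. The
  two measures may live on different spaces and need not be normalised: the induction fixes one coordinate at a
  time by restricting both measures to the event that this coordinate has the prescribed value.
\<close>

lemma laplace_unique:
  fixes X :: "'i \<Rightarrow> 'a \<Rightarrow> enat" and Y :: "'i \<Rightarrow> 'b \<Rightarrow> enat"
  assumes "finite I" "finite_measure P" "finite_measure Q"
    and "\<And>i. i \<in> I \<Longrightarrow> X i \<in> P \<rightarrow>\<^sub>M count_space UNIV"
    and "\<And>i. i \<in> I \<Longrightarrow> Y i \<in> Q \<rightarrow>\<^sub>M count_space UNIV"
    and "\<And>t. (\<integral>\<^sup>+\<omega>. nexp (\<Sum>i\<in>I. t i * ennreal_of_enat (X i \<omega>)) \<partial>P)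
            = (\<integral>\<^sup>+\<omega>. nexp (\<Sum>i\<in>I. t i * ennreal_of_enat (Y i \<omega>)) \<partial>Q)"
  shows "emeasure P {\<omega>\<in>space P. \<forall>i\<in>I. X i \<omega> = m i} = emeasure Q {\<omega>\<in>space Q. \<forall>i\<in>I. Y i \<omega> = m i}"
  using assms
proof (induction I arbitrary: P Q rule: finite_induct)
  case empty
  from empty.prems(5) show ?case by simp
next
  case (insert i I)
  note [measurable] = insert.prems(3)[OF insertI1] insert.prems(4)[OF insertI1]
  have [measurable]: "X j \<in> P \<rightarrow>\<^sub>M count_space UNIV" "Y j \<in> Q \<rightarrow>\<^sub>M count_space UNIV" if "j \<in> I" for j
    using insert.prems that by auto
  interpret P: finite_measure P by fact
  interpret Q: finite_measure Q by fact
  define P' where "P' = density P (indicator {\<omega>\<in>space P. X i \<omega> = m i})"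
  define Q' where "Q' = density Q (indicator {\<omega>\<in>space Q. Y i \<omega> = m i})"
  have em: "emeasure P {\<omega>\<in>space P. \<forall>i\<in>insert i I. X i \<omega> = m i} = emeasure P' {\<omega>\<in>space P'. \<forall>i\<in>I. X i \<omega> = m i}"
    unfolding P'_def using \<open>finite I\<close>
    by (subst emeasure_density)
       (auto intro!: arg_cong[where f = "emeasure P"] simp: nn_integral_indicator[symmetric] indicator_inter_arith[symmetric] simp del: nn_integral_indicator
         intro!: nn_integral_cong split: split_indicator)
  have em': "emeasure Q {\<omega>\<in>space Q. \<forall>i\<in>insert i I. Y i \<omega> = m i} = emeasure Q' {\<omega>\<in>space Q'. \<forall>i\<in>I. Y i \<omega> = m i}"
    unfolding Q'_def using \<open>finite I\<close>
    by (subst emeasure_density)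
       (auto intro!: arg_cong[where f = "emeasure P"] simp: nn_integral_indicator[symmetric] indicator_inter_arith[symmetric] simp del: nn_integral_indicator
         intro!: nn_integral_cong split: split_indicator)
  have fin: "finite_measure P'" "finite_measure Q'"
    unfolding P'_def Q'_def
    by (auto intro!: P.finite_measure_restricted Q.finite_measure_restricted)
  have "(\<integral>\<^sup>+\<omega>. nexp (\<Sum>i\<in>I. t i * ennreal_of_enat (X i \<omega>)) \<partial>P')
      = (\<integral>\<^sup>+\<omega>. nexp (\<Sum>i\<in>I. t i * ennreal_of_enat (Y i \<omega>)) \<partial>Q')" for t
  proof -
    define f where "f \<omega> = nexp (\<Sum>i\<in>I. t i * ennreal_of_enat (X i \<omega>))" for \<omega>
    define g where "g \<omega> = nexp (\<Sum>i\<in>I. t i * ennreal_of_enat (Y i \<omega>))" for \<omega>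
    have [measurable]: "f \<in> borel_measurable P" "g \<in> borel_measurable Q"
      unfolding f_def g_def by measurable
    \<comment> \<open>For fixed \<open>t\<close> on \<open>I\<close>, the one-variable result applies to the law of coordinate \<open>i\<close> weighted by the factor of the other coordinates.\<close>
    define \<rho> where "\<rho> = distr (density P f) (count_space UNIV) (X i)"
    define \<sigma> where "\<sigma> = distr (density Q g) (count_space UNIV) (Y i)"
    have le: "f \<omega> \<le> 1" "g \<omega>' \<le> 1" for \<omega> \<omega>' by (auto simp: f_def g_def nexp_le_1)
    have "emeasure \<rho> {m i} = emeasure \<sigma> {m i}"
    proof (rule laplace_unique_enat)
      have "(\<integral>\<^sup>+\<omega>. f \<omega> \<partial>P) \<le> (\<integral>\<^sup>+\<omega>. 1 \<partial>P)" by (intro nn_integral_mono le)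
      also have "\<dots> < top" by (simp add: less_top[symmetric])
      finally show "finite_measure \<rho>"
        unfolding \<rho>_def by (intro finite_measureI) (auto simp: emeasure_distr emeasure_density cong: nn_integral_cong)
      have "(\<integral>\<^sup>+\<omega>. g \<omega> \<partial>Q) \<le> (\<integral>\<^sup>+\<omega>. 1 \<partial>Q)" by (intro nn_integral_mono le)
      also have "\<dots> < top" by (simp add: less_top[symmetric])
      finally show "finite_measure \<sigma>"
        unfolding \<sigma>_def by (intro finite_measureI) (auto simp: emeasure_distr emeasure_density cong: nn_integral_cong)
      fix s :: ennreal
      have *: "(\<Sum>j\<in>insert i I. (t(i := s)) j * h j) = (\<Sum>j\<in>I. t j * h j) + s * h i" for h
        using insert.hyps by (auto simp: add.commute intro!: arg_cong2[where f = "(+)"] sum.cong)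
      show "(\<integral>\<^sup>+x. nexp (s * ennreal_of_enat x) \<partial>\<rho>) = (\<integral>\<^sup>+x. nexp (s * ennreal_of_enat x) \<partial>\<sigma>)"
        using insert.prems(5)[of "t(i := s)"]
        unfolding * nexp_add f_def[symmetric] g_def[symmetric]
        by (simp add: \<rho>_def \<sigma>_def nn_integral_distr nn_integral_density)
    qed (simp_all add: \<rho>_def \<sigma>_def)
    then show ?thesis
      unfolding f_def[symmetric] g_def[symmetric] P'_def Q'_def
      by (simp add: \<rho>_def \<sigma>_def emeasure_distr emeasure_density nn_integral_density)
         (simp add: vimage_def Int_def conj_commute mult.commute)
  qed
  then have "emeasure P' {\<omega>\<in>space P'. \<forall>i\<in>I. X i \<omega> = m i} = emeasure Q' {\<omega>\<in>space Q'. \<forall>i\<in>I. Y i \<omega> = m i}"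
    by (intro insert.IH fin) (simp_all add: P'_def Q'_def)
  then show ?case unfolding em em' .
qed

section \<open>The sigma-algebra of random collections\<close>

text \<open>
  The number of points in a set as an extended natural number instead of an extended real.
\<close>

definition enat_points :: "('a \<Rightarrow> enat) \<Rightarrow> 'a set \<Rightarrow> enat" where
  "enat_points c A = (if finite {a\<in>A. c a \<noteq> 0} then \<Sum>a\<in>{a\<in>A. c a \<noteq> 0}. c a else \<infinity>)"

lemma num_points_eq: "num_points c A = ennreal_of_enat (enat_points c A)"
proof (cases "finite {a\<in>A. c a \<noteq> 0}")
  case True
  then have "num_points c A = (\<Sum>a\<in>{a\<in>A. c a \<noteq> 0}. ennreal_of_enat (c a))"
    unfolding num_points_def by (intro nn_integral_count_space') auto
  with True show ?thesis by (simp add: enat_points_def)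
next
  case False
  have "\<infinity> = (\<integral>\<^sup>+a. indicator {a\<in>A. c a \<noteq> 0} a \<partial>count_space A)"
    using False by (subst nn_integral_indicator) (auto simp: emeasure_count_space)
  also have "\<dots> \<le> num_points c A"
    unfolding num_points_def
  proof (intro nn_integral_mono)
    fix a
    have "1 \<le> ennreal_of_enat (c a)" if "c a \<noteq> 0"
      using that by (metis ennreal_of_enat_1 ennreal_of_enat_le_iff iless_eSuc0 not_le one_eSuc)
    then show "indicator {a\<in>A. c a \<noteq> 0} a \<le> ennreal_of_enat (c a)"
      by (auto split: split_indicator)
  qed
  finally show ?thesis using False by (simp add: enat_points_def top_unique)
qed

lemma enat_points_eq_iff: "enat_points c A = n \<longleftrightarrow> num_points c A = ennreal_of_enat n"
  by (simp add: num_points_eq)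

lemma num_points_UNIV:
  "num_points c A = (\<integral>\<^sup>+a. indicator A a * ennreal_of_enat (c a) \<partial>count_space UNIV)"
  unfolding num_points_def
  by (subst nn_integral_count_space_indicator) (auto simp: mult.commute)

lemma sum_num_points:
  assumes "finite I"
  shows "(\<Sum>i\<in>I. t i * num_points c (B i))
    = (\<integral>\<^sup>+a. (\<Sum>i\<in>I. t i * indicator (B i) a) * ennreal_of_enat (c a) \<partial>count_space UNIV)"
  by (simp add: num_points_UNIV sum_distrib_right mult.assoc nn_integral_sum nn_integral_cmult)

lemma space_collections [simp]: "space (collections M) = collection_set M"
proof -
  have "sets M \<noteq> {}" by auto
  then show ?thesis
    unfolding collections_def by (subst space_Sup_eq_UN) auto
qed

lemma measurable_num_points [measurable]:
  assumes "A \<in> sets M"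
  shows "(\<lambda>c. num_points c A) \<in> borel_measurable (collections M)"
  unfolding collections_def
  by (rule measurable_Sup1[where m = "vimage_algebra (collection_set M) (\<lambda>c. num_points c A) borel"])
     (use assms in \<open>auto intro!: measurable_vimage_algebra1\<close>)

lemma measurable_enat_points [measurable]:
  assumes [measurable]: "A \<in> sets M"
  shows "(\<lambda>c. enat_points c A) \<in> collections M \<rightarrow>\<^sub>M count_space UNIV"
proof (subst measurable_count_space_eq2_countable, safe)
  fix n
  have "(\<lambda>c. enat_points c A) -` {n} \<inter> space (collections M)
    = {c\<in>space (collections M). num_points c A = ennreal_of_enat n}"
    by (auto simp: num_points_eq)
  also have "\<dots> \<in> sets (collections M)" by measurable
  finally show "(\<lambda>c. enat_points c A) -` {n} \<inter> space (collections M) \<in> sets (collections M)" .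
qed simp

lemma sets_enat_points_eq:
  "A \<in> sets M \<Longrightarrow> {c\<in>space (collections M). enat_points c A = n} \<in> sets (collections M)"
  by measurable

lemma measurable_collectionsI:
  assumes "\<And>x. x \<in> space N \<Longrightarrow> f x \<in> collection_set M"
    and "\<And>A. A \<in> sets M \<Longrightarrow> (\<lambda>x. num_points (f x) A) \<in> borel_measurable N"
  shows "f \<in> N \<rightarrow>\<^sub>M collections M"
  unfolding collections_def
  by (rule measurable_SUP2) (use assms in \<open>auto intro!: measurable_vimage_algebra2\<close>)

text \<open>
  The collections whose counts in the sets of a family \<open>F\<close> lie in prescribed sets of values. For finite
  families of measurable sets they form a generator of the sigma-algebra that is closed under intersections.
\<close>

definition count_cylinder :: "'a measure \<Rightarrow> 'a set set \<Rightarrow> ('a set \<Rightarrow> enat set) \<Rightarrow> ('a \<Rightarrow> enat) set" where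
  "count_cylinder M F S = {c\<in>collection_set M. \<forall>A\<in>F. enat_points c A \<in> S A}"

definition count_cylinders :: "'a measure \<Rightarrow> ('a \<Rightarrow> enat) set set" where
  "count_cylinders M = {count_cylinder M F S | F S. finite F \<and> F \<subseteq> sets M}"

lemma Int_stable_count_cylinders: "Int_stable (count_cylinders M)"
proof (rule Int_stableI)
  fix X Y assume "X \<in> count_cylinders M" "Y \<in> count_cylinders M"
  then obtain F S G T where *: "finite F" "F \<subseteq> sets M" "X = count_cylinder M F S"
      "finite G" "G \<subseteq> sets M" "Y = count_cylinder M G T"
    unfolding count_cylinders_def by blast
  have "X \<inter> Y = count_cylinder M (F \<union> G)
      (\<lambda>A. (if A \<in> F then S A else UNIV) \<inter> (if A \<in> G then T A else UNIV))"
    unfolding * count_cylinder_def by (auto split: if_splits)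
  with * show "X \<inter> Y \<in> count_cylinders M"
    unfolding count_cylinders_def by blast
qed

lemma count_cylinders_subset: "count_cylinders M \<subseteq> Pow (collection_set M)"
  by (auto simp: count_cylinders_def count_cylinder_def)

lemma sets_collections: "sets (collections M) = sigma_sets (collection_set M) (count_cylinders M)"
proof (rule antisym)
  have "(\<lambda>c. c) \<in> sigma (collection_set M) (count_cylinders M) \<rightarrow>\<^sub>M collections M"
  proof (rule measurable_collectionsI)
    fix A assume A: "A \<in> sets M"
    show "(\<lambda>c. num_points c A) \<in> borel_measurable (sigma (collection_set M) (count_cylinders M))"
    proof (rule measurableI)
      fix X :: "ennreal set"
      have "(\<lambda>c. num_points c A) -` X \<inter> collection_set M
          = count_cylinder M {A} (\<lambda>_. {n. ennreal_of_enat n \<in> X})"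
        by (auto simp: count_cylinder_def num_points_eq)
      with A have "(\<lambda>c. num_points c A) -` X \<inter> collection_set M \<in> count_cylinders M"
        unfolding count_cylinders_def by blast
      then show "(\<lambda>c. num_points c A) -` X \<inter> space (sigma (collection_set M) (count_cylinders M))
          \<in> sets (sigma (collection_set M) (count_cylinders M))"
        using count_cylinders_subset[of M] by (simp add: space_measure_of_conv sigma_sets.Basic)
    qed simp
  qed (simp add: space_measure_of_conv)
  from measurable_sets[OF this] show "sets (collections M) \<subseteq> sigma_sets (collection_set M) (count_cylinders M)"
    using count_cylinders_subset[of M] sets.sets_into_space[of _ "collections M"]
    by (auto simp: space_measure_of_conv Int_absorb2)
next
  have "X \<in> sets (collections M)" if "X \<in> count_cylinders M" for X
  proof -
    from that obtain F S where F: "finite F" "F \<subseteq> sets M" "X = count_cylinder M F S"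
      unfolding count_cylinders_def by blast
    have "{c\<in>space (collections M). enat_points c A \<in> S A} \<in> sets (collections M)" if "A \<in> F" for A
    proof -
      have [measurable]: "A \<in> sets M" using that F by auto
      show ?thesis by measurable
    qed
    then have "{c\<in>space (collections M). \<forall>A\<in>F. enat_points c A \<in> S A} \<in> sets (collections M)"
      using F(1) by (intro sets.sets_Collect_finite_All) auto
    with F show ?thesis by (simp add: count_cylinder_def)
  qed
  then show "sigma_sets (collection_set M) (count_cylinders M) \<subseteq> sets (collections M)"
    using sets.sigma_sets_subset[of "count_cylinders M" "collections M"] by auto
qed

text \<open>
  The points of the space that belong to exactly the members \<open>G\<close> of the family \<open>F\<close>.
\<close>

definition atom :: "'a measure \<Rightarrow> 'a set set \<Rightarrow> 'a set set \<Rightarrow> 'a set" where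
  "atom M F G = {x\<in>space M. \<forall>A\<in>F. x \<in> A \<longleftrightarrow> A \<in> G}"

lemma sets_atom: "finite F \<Longrightarrow> F \<subseteq> sets M \<Longrightarrow> atom M F G \<in> sets M"
  unfolding atom_def by (intro sets.sets_Collect_finite_All) auto

lemma disjoint_atom: "disjoint_family_on (atom M F) (Pow F)"
  unfolding disjoint_family_on_def atom_def by blast

lemma enat_points_atoms:
  assumes F: "finite F" "A \<in> F" and c: "c \<in> collection_set M"
  shows "enat_points c A = (\<Sum>G\<in>{G\<in>Pow F. A \<in> G}. enat_points c (atom M F G))"
proof -
  have "num_points c A = (\<integral>\<^sup>+a. (\<Sum>G\<in>{G\<in>Pow F. A \<in> G}. 1 * indicator (atom M F G) a) * ennreal_of_enat (c a) \<partial>count_space UNIV)"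
    unfolding num_points_UNIV
  proof (intro nn_integral_cong)
    fix a
    show "indicator A a * ennreal_of_enat (c a) = (\<Sum>G\<in>{G\<in>Pow F. A \<in> G}. 1 * indicator (atom M F G) a) * ennreal_of_enat (c a)"
    proof (cases "c a = 0")
      case False
      with c have "a \<in> space M" by (auto simp: collection_set_def)
      then have "a \<in> atom M F G \<longleftrightarrow> G = {B\<in>F. a \<in> B}" if "G \<subseteq> F" for G
        using that by (auto simp: atom_def)
      then have "(\<Sum>G\<in>{G\<in>Pow F. A \<in> G}. 1 * indicator (atom M F G) a)
         = (\<Sum>G\<in>{G\<in>Pow F. A \<in> G}. if G = {B\<in>F. a \<in> B} then 1 else 0 :: ennreal)"
        by (intro sum.cong) (auto simp: indicator_def)
      also have "\<dots> = indicator A a"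
        using F by (subst sum.delta) (auto simp: indicator_def)
      finally show ?thesis by simp
    qed simp
  qed
  also have "\<dots> = (\<Sum>G\<in>{G\<in>Pow F. A \<in> G}. 1 * num_points c (atom M F G))"
    using F by (subst sum_num_points) auto
  finally show ?thesis by (simp add: num_points_eq)
qed

text \<open>
  The counts in a finite family are sums of the counts in its disjoint atoms, and the vector of the latter has
  countably many values. Hence the probability of a cylinder is a countable sum of joint probabilities for
  disjoint sets, so that equality of laws and measurability in a parameter can be checked on disjoint families.
\<close>

lemma emeasure_count_cylinder:
  fixes S :: "'a set \<Rightarrow> enat set"
  assumes P [measurable_cong]: "sets P = sets (collections M)" and F: "finite F" "F \<subseteq> sets M"
  defines "K \<equiv> {k \<in> Pow F \<rightarrow>\<^sub>E UNIV. \<forall>A\<in>F. (\<Sum>G\<in>{G\<in>Pow F. A \<in> G}. k G) \<in> S A}"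
  shows "emeasure P (count_cylinder M F S)
    = (\<integral>\<^sup>+k. emeasure P {c\<in>collection_set M. \<forall>G\<in>Pow F. enat_points c (atom M F G) = k G} \<partial>count_space K)"
proof -
  define E where "E k = {c\<in>collection_set M. \<forall>G\<in>Pow F. enat_points c (atom M F G) = k G}" for k
  have [measurable]: "atom M F G \<in> sets M" for G
    using F by (rule sets_atom)
  have "count_cylinder M F S = (\<Union>k\<in>K. E k)"
  proof safe
    fix c assume c: "c \<in> count_cylinder M F S"
    define k where "k = restrict (\<lambda>G. enat_points c (atom M F G)) (Pow F)"
    have "(\<Sum>G\<in>{G\<in>Pow F. A \<in> G}. k G) = enat_points c A" if "A \<in> F" for A
      using c F that by (subst enat_points_atoms[of F A c M]) (auto simp: k_def count_cylinder_def intro!: sum.cong)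
    with c have "k \<in> K" by (auto simp: K_def k_def count_cylinder_def)
    moreover have "c \<in> E k" using c by (auto simp: E_def k_def count_cylinder_def)
    ultimately show "c \<in> (\<Union>k\<in>K. E k)" by blast
  next
    fix c k assume k: "k \<in> K" and c: "c \<in> E k"
    have "enat_points c A = (\<Sum>G\<in>{G\<in>Pow F. A \<in> G}. k G)" if "A \<in> F" for A
      using c F that by (subst enat_points_atoms[of F A c M]) (auto simp: E_def intro!: sum.cong)
    with k c show "c \<in> count_cylinder M F S" by (auto simp: E_def K_def count_cylinder_def)
  qed
  moreover have "countable K"
  proof (rule countable_subset)
    show "countable (Pow F \<rightarrow>\<^sub>E (UNIV :: enat set))" using F by (intro countable_PiE) auto
  qed (auto simp: K_def)
  moreover have "E k \<in> sets P" for k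
  proof -
    have "{c\<in>space (collections M). \<forall>G\<in>Pow F. enat_points c (atom M F G) = k G} \<in> sets (collections M)"
      using F by (intro sets.sets_Collect_finite_All sets_enat_points_eq) auto
    then show ?thesis by (simp add: E_def P)
  qed
  moreover have "disjoint_family_on E K"
  proof (unfold disjoint_family_on_def, safe)
    fix k k' c assume *: "k \<in> K" "k' \<in> K" "k \<noteq> k'" "c \<in> E k" "c \<in> E k'"
    then have "k = k'" by (intro PiE_ext[of k "Pow F" "\<lambda>_. UNIV"]) (auto simp: K_def E_def)
    with * show "c \<in> {}" by simp
  qed
  ultimately show ?thesis
    unfolding E_def[symmetric] by (simp add: emeasure_UN_countable)
qed

lemma collections_measure_eqI:
  fixes M :: "'a measure"
  assumes P: "prob_space P" "sets P = sets (collections M)"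
    and Q: "prob_space Q" "sets Q = sets (collections M)"
    and eq: "\<And>(I :: 'a set set set) B m. finite I \<Longrightarrow> (\<And>i. i \<in> I \<Longrightarrow> B i \<in> sets M) \<Longrightarrow> disjoint_family_on B I \<Longrightarrow>
      emeasure P {c\<in>collection_set M. \<forall>i\<in>I. enat_points c (B i) = m i}
    = emeasure Q {c\<in>collection_set M. \<forall>i\<in>I. enat_points c (B i) = m i}"
  shows "P = Q"
proof (rule measure_eqI_generator_eq)
  show "Int_stable (count_cylinders M)" by (rule Int_stable_count_cylinders)
  show "count_cylinders M \<subseteq> Pow (collection_set M)" by (rule count_cylinders_subset)
  fix X assume "X \<in> count_cylinders M"
  then obtain F S where F: "finite F" "F \<subseteq> sets M" "X = count_cylinder M F S"
    unfolding count_cylinders_def by blast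
  have "emeasure P {c\<in>collection_set M. \<forall>G\<in>Pow F. enat_points c (atom M F G) = k G}
      = emeasure Q {c\<in>collection_set M. \<forall>G\<in>Pow F. enat_points c (atom M F G) = k G}" for k
    using F(1) sets_atom[OF F(1,2)] disjoint_atom by (intro eq[of "Pow F" "atom M F" k]) auto
  then show "emeasure P X = emeasure Q X"
    using F by (simp add: emeasure_count_cylinder[OF P(2)] emeasure_count_cylinder[OF Q(2)] del: Pow_iff)
next
  show "sets P = sigma_sets (collection_set M) (count_cylinders M)"
    "sets Q = sigma_sets (collection_set M) (count_cylinders M)"
    using P Q by (simp_all add: sets_collections)
  have "collection_set M = count_cylinder M {} (\<lambda>_. UNIV)"
    by (auto simp: count_cylinder_def)
  then show "range (\<lambda>n::nat. collection_set M) \<subseteq> count_cylinders M"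
    by (auto simp: count_cylinders_def)
  show "emeasure P (collection_set M) \<noteq> \<infinity>"
    using prob_space.emeasure_space_1[OF P(1)] sets_eq_imp_space_eq[OF P(2)] by simp
qed simp

lemma borel_measurable_nn_integral_count_space:
  fixes f :: "'i \<Rightarrow> 'a \<Rightarrow> ennreal"
  assumes "countable I" and [measurable]: "\<And>i. i \<in> I \<Longrightarrow> f i \<in> borel_measurable M"
  shows "(\<lambda>x. \<integral>\<^sup>+i. f i x \<partial>count_space I) \<in> borel_measurable M"
proof (cases "finite I")
  case True
  then show ?thesis by (simp add: nn_integral_count_space_finite)
next
  case False
  have "(\<lambda>x. \<Sum>n. f (from_nat_into I n) x) \<in> borel_measurable M"
    using False by (intro borel_measurable_suminf_order assms from_nat_into) auto
  then show ?thesis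
    by (simp add: nn_integral_bij_count_space[OF bij_betw_from_nat_into[OF assms(1) False], symmetric]
        nn_integral_count_space_nat)
qed

lemma measurable_collections_kernel:
  fixes M :: "'a measure"
  assumes P: "\<And>x. x \<in> space N \<Longrightarrow> prob_space (P x)" "\<And>x. x \<in> space N \<Longrightarrow> sets (P x) = sets (collections M)"
    and meas: "\<And>(I :: 'a set set set) B m. finite I \<Longrightarrow> (\<And>i. i \<in> I \<Longrightarrow> B i \<in> sets M) \<Longrightarrow> disjoint_family_on B I \<Longrightarrow>
      (\<lambda>x. emeasure (P x) {c\<in>collection_set M. \<forall>i\<in>I. enat_points c (B i) = m i}) \<in> borel_measurable N"
  shows "P \<in> N \<rightarrow>\<^sub>M prob_algebra (collections M)"
proof (rule measurable_prob_algebra_generated)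
  show "sets (collections M) = sigma_sets (collection_set M) (count_cylinders M)" by (rule sets_collections)
  show "Int_stable (count_cylinders M)" by (rule Int_stable_count_cylinders)
  show "count_cylinders M \<subseteq> Pow (collection_set M)" by (rule count_cylinders_subset)
  fix X assume "X \<in> count_cylinders M"
  then obtain F S where F: "finite F" "F \<subseteq> sets M" "X = count_cylinder M F S"
    unfolding count_cylinders_def by blast
  define K where "K = {k \<in> Pow F \<rightarrow>\<^sub>E UNIV. \<forall>A\<in>F. (\<Sum>G\<in>{G\<in>Pow F. A \<in> G}. k G) \<in> S A}"
  have K: "countable K"
  proof (rule countable_subset)
    show "countable (Pow F \<rightarrow>\<^sub>E (UNIV :: enat set))" using F by (intro countable_PiE) auto
  qed (auto simp: K_def)
  have "(\<lambda>x. \<integral>\<^sup>+k. emeasure (P x) {c\<in>collection_set M. \<forall>G\<in>Pow F. enat_points c (atom M F G) = k G} \<partial>count_space K)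
      \<in> borel_measurable N"
    using F sets_atom[OF F(1,2)] disjoint_atom
    by (intro borel_measurable_nn_integral_count_space K meas) auto
  then show "(\<lambda>x. emeasure (P x) X) \<in> borel_measurable N"
    using F emeasure_count_cylinder[OF P(2) F(1,2)]
    by (simp add: K_def cong: measurable_cong)
qed (use P in auto)

section \<open>Laplace functionals of countable independent sums\<close>

lemma nn_integral_PiM_prod:
  fixes f :: "'i \<Rightarrow> 'a \<Rightarrow> ennreal"
  assumes N: "\<And>j. j \<in> J \<Longrightarrow> prob_space (N j)" and F: "finite F" "F \<subseteq> J"
    and f: "\<And>j. j \<in> F \<Longrightarrow> f j \<in> borel_measurable (N j)"
  shows "(\<integral>\<^sup>+\<omega>. (\<Prod>j\<in>F. f j (\<omega> j)) \<partial>PiM J N) = (\<Prod>j\<in>F. \<integral>\<^sup>+x. f j x \<partial>N j)"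
proof -
  define N' where "N' j = (if j \<in> J then N j else count_space {undefined})" for j
  interpret N': prob_space "N' j" for j
    using N by (cases "j \<in> J") (auto simp: N'_def intro!: prob_spaceI)
  interpret product_prob_space N' J ..
  have f' [measurable]: "f j \<in> borel_measurable (N' j)" if "j \<in> F" for j
    using that F f by (auto simp: N'_def)
  have [measurable]: "(\<lambda>\<omega>. \<Prod>j\<in>F. f j (\<omega> j)) \<in> borel_measurable (PiM F N')"
    by (intro borel_measurable_prod_ennreal) measurable
  have PiM_eq: "PiM J N = PiM J N'"
    by (rule PiM_cong) (auto simp: N'_def)
  have "(\<integral>\<^sup>+\<omega>. (\<Prod>j\<in>F. f j (\<omega> j)) \<partial>PiM J N) = (\<integral>\<^sup>+\<omega>. (\<Prod>j\<in>F. f j (restrict \<omega> F j)) \<partial>PiM J N')"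
    unfolding PiM_eq by (intro nn_integral_cong prod.cong) auto
  also have "\<dots> = (\<integral>\<^sup>+\<omega>. (\<Prod>j\<in>F. f j (\<omega> j)) \<partial>distr (PiM J N') (PiM F N') (\<lambda>\<omega>. restrict \<omega> F))"
    using F by (subst nn_integral_distr) (auto intro!: measurable_restrict_subset)
  also have "\<dots> = (\<Prod>j\<in>F. \<integral>\<^sup>+x. f j x \<partial>N' j)"
    using F f' by (subst distr_PiM_restrict_finite) (auto simp: product_nn_integral_prod)
  also have "\<dots> = (\<Prod>j\<in>F. \<integral>\<^sup>+x. f j x \<partial>N j)"
    using F by (intro prod.cong) (auto simp: N'_def)
  finally show ?thesis .
qed

lemma nn_integral_count_space_SUP:
  fixes f :: "'i \<Rightarrow> ennreal"
  assumes "\<And>k. finite (F k)" "incseq F" "(\<Union>k. F k) = J"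
  shows "(\<integral>\<^sup>+j. f j \<partial>count_space J) = (SUP k. \<Sum>j\<in>F k. f j)"
proof -
  have "(\<integral>\<^sup>+j. f j \<partial>count_space J) = (\<integral>\<^sup>+j. (SUP k. f j * indicator (F k) j) \<partial>count_space J)"
  proof (intro nn_integral_cong)
    fix j assume "j \<in> space (count_space J)"
    then obtain k where k: "j \<in> F k" using assms(3) by auto
    show "f j = (SUP k. f j * indicator (F k) j)"
    proof (intro antisym SUP_least)
      show "f j \<le> (SUP k. f j * indicator (F k) j)"
        using k by (intro SUP_upper2[of k]) auto
    qed (auto split: split_indicator)
  qed
  also have "\<dots> = (SUP k. \<integral>\<^sup>+j. f j * indicator (F k) j \<partial>count_space J)"
    using \<open>incseq F\<close>
    by (intro nn_integral_monotone_convergence_SUP)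
       (auto simp: incseq_def le_fun_def subset_eq split: split_indicator)
  also have "\<dots> = (SUP k. \<Sum>j\<in>F k. f j)"
  proof (intro SUP_cong refl)
    fix k
    have "F k \<subseteq> J" using assms(3) by auto
    then have "(\<integral>\<^sup>+j. f j * indicator (F k) j \<partial>count_space J) = (\<Sum>j\<in>F k. f j * indicator (F k) j)"
      using assms(1) by (intro nn_integral_count_space') auto
    then show "(\<integral>\<^sup>+j. f j * indicator (F k) j \<partial>count_space J) = (\<Sum>j\<in>F k. f j)" by simp
  qed
  finally show ?thesis .
qed

text \<open>
  The Laplace transform of a countable sum of independent nonnegative variables is the product of the Laplace
  transforms, stated through exponents so that no infinite product occurs. The proof passes to the limit along an
  increasing sequence of finite index sets.
\<close>

lemma nn_integral_PiM_nexp: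
  fixes f :: "'i \<Rightarrow> 'a \<Rightarrow> ennreal"
  assumes J: "countable J" and N: "\<And>j. j \<in> J \<Longrightarrow> prob_space (N j)"
    and f [measurable]: "\<And>j. j \<in> J \<Longrightarrow> f j \<in> borel_measurable (N j)"
    and h: "\<And>j. j \<in> J \<Longrightarrow> (\<integral>\<^sup>+x. nexp (f j x) \<partial>N j) = nexp (h j)"
  shows "(\<integral>\<^sup>+\<omega>. nexp (\<integral>\<^sup>+j. f j (\<omega> j) \<partial>count_space J) \<partial>PiM J N) = nexp (\<integral>\<^sup>+j. h j \<partial>count_space J)"
proof -
  define F where "F k = {j\<in>J. to_nat_on J j < k}" for k
  have finF: "finite (F k)" for k
    using J inj_on_subset[OF inj_on_to_nat_on[OF J], of "F k"]
    by (intro inj_on_finite[of "to_nat_on J" "F k" "{..<k}"]) (auto simp: F_def)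
  have F: "incseq F" "(\<Union>k. F k) = J"
    by (auto simp: F_def incseq_def)
  note sub = F(2)
  have FJ: "F k \<subseteq> J" for k by (auto simp: F_def)
  interpret P: prob_space "PiM J N" using N by (rule prob_space_PiM)
  have mf: "(\<lambda>\<omega>. f j (\<omega> j)) \<in> borel_measurable (PiM J N)" if "j \<in> J" for j
    using measurable_component_singleton[OF that, of N] f[OF that] by (rule measurable_compose)
  have [measurable]: "(\<lambda>\<omega>. \<Sum>j\<in>F k. f j (\<omega> j)) \<in> borel_measurable (PiM J N)" for k
    by (intro borel_measurable_sum mf) (use FJ in blast)
  have inc: "incseq (\<lambda>k. \<Sum>j\<in>F k. g j)" for g :: "'i \<Rightarrow> ennreal"
    using finF F(1) by (auto simp: incseq_def intro!: sum_mono2)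
  have "(\<integral>\<^sup>+\<omega>. nexp (\<integral>\<^sup>+j. f j (\<omega> j) \<partial>count_space J) \<partial>PiM J N)
      = (\<integral>\<^sup>+\<omega>. (INF k. nexp (\<Sum>j\<in>F k. f j (\<omega> j))) \<partial>PiM J N)"
    by (simp add: nn_integral_count_space_SUP[OF finF F] nexp_SUP[OF inc])
  also have "\<dots> = (INF k. \<integral>\<^sup>+\<omega>. nexp (\<Sum>j\<in>F k. f j (\<omega> j)) \<partial>PiM J N)"
  proof (rule nn_integral_monotone_convergence_INF_decseq)
    show "decseq (\<lambda>k \<omega>. nexp (\<Sum>j\<in>F k. f j (\<omega> j)))"
    proof (intro antimonoI le_funI nexp_antimono)
      fix k l :: nat and \<omega> assume "k \<le> l"
      with inc[of "\<lambda>j. f j (\<omega> j)"] show "(\<Sum>j\<in>F k. f j (\<omega> j)) \<le> (\<Sum>j\<in>F l. f j (\<omega> j))"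
        by (simp add: incseq_def)
    qed
    have "(\<integral>\<^sup>+\<omega>. nexp (\<Sum>j\<in>F 0. f j (\<omega> j)) \<partial>PiM J N) \<le> (\<integral>\<^sup>+\<omega>. 1 \<partial>PiM J N)"
      by (intro nn_integral_mono nexp_le_1)
    then show "(\<integral>\<^sup>+\<omega>. nexp (\<Sum>j\<in>F 0. f j (\<omega> j)) \<partial>PiM J N) < \<infinity>"
      by (auto simp: P.emeasure_space_1 intro: le_less_trans)
  qed measurable
  also have "\<dots> = (INF k. nexp (\<Sum>j\<in>F k. h j))"
  proof (intro INF_cong refl)
    fix k
    have "(\<integral>\<^sup>+\<omega>. nexp (\<Sum>j\<in>F k. f j (\<omega> j)) \<partial>PiM J N) = (\<Prod>j\<in>F k. \<integral>\<^sup>+x. nexp (f j x) \<partial>N j)"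
      unfolding nexp_sum using FJ
      by (intro nn_integral_PiM_prod[OF N finF] measurable_compose[OF f borel_measurable_nexp]) auto
    also have "\<dots> = nexp (\<Sum>j\<in>F k. h j)"
      unfolding nexp_sum using FJ h by (intro prod.cong) auto
    finally show "(\<integral>\<^sup>+\<omega>. nexp (\<Sum>j\<in>F k. f j (\<omega> j)) \<partial>PiM J N) = nexp (\<Sum>j\<in>F k. h j)" .
  qed
  also have "\<dots> = nexp (\<integral>\<^sup>+j. h j \<partial>count_space J)"
    by (simp add: nn_integral_count_space_SUP[OF finF F] nexp_SUP[OF inc])
  finally show ?thesis .
qed

section \<open>Poisson processes and their Laplace functional\<close>

lemma collections_cong: "sets M = sets N \<Longrightarrow> collections M = collections N"
  using sets_eq_imp_space_eq[of M N] by (simp add: collections_def collection_set_def)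

text \<open>
  The Laplace functional of a Poisson process with intensity \<open>M\<close> at a function \<open>g\<close> is
  \<open>nexp (\<integral>\<^sup>+ x. (1 - nexp (g x)) \<partial>M)\<close>. Step functions \<open>g\<close> with disjoint level sets \<open>B i\<close> and values \<open>t i\<close> suffice, and
  no finiteness of the intensity is required.
\<close>

definition has_poisson_laplace :: "'a measure \<Rightarrow> ('a \<Rightarrow> enat) measure \<Rightarrow> bool" where
  "has_poisson_laplace M P \<longleftrightarrow> prob_space P \<and> sets P = sets (collections M) \<and>
    (\<forall>(n::nat) B t. (\<forall>i<n. B i \<in> sets M) \<longrightarrow> disjoint_family_on B {..<n} \<longrightarrow>
      (\<integral>\<^sup>+c. nexp (\<Sum>i<n. t i * num_points c (B i)) \<partial>P) = nexp (\<Sum>i<n. (1 - nexp (t i)) * emeasure M (B i)))"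

lemma has_poisson_laplaceD:
  assumes P: "has_poisson_laplace M P" and I: "finite I"
    and B: "\<And>i. i \<in> I \<Longrightarrow> B i \<in> sets M" "disjoint_family_on B I"
  shows "(\<integral>\<^sup>+c. nexp (\<Sum>i\<in>I. t i * num_points c (B i)) \<partial>P) = nexp (\<Sum>i\<in>I. (1 - nexp (t i)) * emeasure M (B i))"
proof -
  obtain h where h: "bij_betw h {..<card I} I"
    using ex_bij_betw_nat_finite[OF I] by (auto simp: atLeast0LessThan)
  have "disjoint_family_on (\<lambda>i. B (h i)) {..<card I}"
  proof (unfold disjoint_family_on_def, intro ballI impI)
    fix i j assume "i \<in> {..<card I}" "j \<in> {..<card I}" "i \<noteq> j"
    with h have "h i \<in> I" "h j \<in> I" "h i \<noteq> h j" by (auto simp: bij_betw_def inj_on_def)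
    with B(2) show "B (h i) \<inter> B (h j) = {}" by (auto simp: disjoint_family_on_def)
  qed
  moreover have "\<forall>i<card I. B (h i) \<in> sets M"
    using B(1) h by (auto simp: bij_betw_def)
  ultimately have "(\<integral>\<^sup>+c. nexp (\<Sum>i<card I. t (h i) * num_points c (B (h i))) \<partial>P)
      = nexp (\<Sum>i<card I. (1 - nexp (t (h i))) * emeasure M (B (h i)))"
    using P[unfolded has_poisson_laplace_def, THEN conjunct2, THEN conjunct2, rule_format, of "card I" "\<lambda>i. B (h i)" "\<lambda>i. t (h i)"]
    by simp
  then show ?thesis
    by (simp add: sum.reindex_bij_betw[OF h, of "\<lambda>i. t i * num_points _ (B i)"]
        sum.reindex_bij_betw[OF h, of "\<lambda>i. (1 - nexp (t i)) * emeasure M (B i)"])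
qed

text \<open>
  The Laplace functional factorises over disjoint sets, so the counts have the same joint Laplace transform as under
  the product of their marginal laws.
\<close>

lemma has_poisson_laplace_indep:
  assumes P: "has_poisson_laplace M P" and I: "finite I"
    and B: "\<And>i. i \<in> I \<Longrightarrow> B i \<in> sets M" "disjoint_family_on B I"
  shows "emeasure P {c\<in>collection_set M. \<forall>i\<in>I. enat_points c (B i) = m i}
    = (\<Prod>i\<in>I. emeasure P {c\<in>collection_set M. enat_points c (B i) = m i})"
proof -
  have sets [measurable_cong]: "sets P = sets (collections M)"
    using P by (simp add: has_poisson_laplace_def)
  have space: "space P = collection_set M"
    using sets_eq_imp_space_eq[OF sets] by simp
  interpret P: prob_space P using P by (simp add: has_poisson_laplace_def)
  \<comment> \<open>The product of the marginal laws of the counts.\<close>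
  define L where "L i = distr P (count_space UNIV) (\<lambda>c. enat_points c (B i))" for i
  have X [measurable]: "(\<lambda>c. enat_points c (B i)) \<in> P \<rightarrow>\<^sub>M count_space UNIV" if "i \<in> I" for i
    using B(1)[OF that] by measurable
  have L: "prob_space (L i)" if "i \<in> I" for i
    unfolding L_def using X[OF that] by (rule P.prob_space_distr)
  interpret Q: prob_space "PiM I L" by (rule prob_space_PiM) (rule L)
  have "emeasure P {c\<in>space P. \<forall>i\<in>I. enat_points c (B i) = m i}
      = emeasure (PiM I L) {\<omega>\<in>space (PiM I L). \<forall>i\<in>I. \<omega> i = m i}"
  proof (rule laplace_unique[OF I])
    fix t :: "'b \<Rightarrow> ennreal"
    have "(\<integral>\<^sup>+\<omega>. nexp (\<Sum>i\<in>I. t i * ennreal_of_enat (\<omega> i)) \<partial>PiM I L)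
        = (\<Prod>i\<in>I. \<integral>\<^sup>+x. nexp (t i * ennreal_of_enat x) \<partial>L i)"
      unfolding nexp_sum by (intro nn_integral_PiM_prod I L) (auto simp: L_def)
    also have "\<dots> = (\<Prod>i\<in>I. \<integral>\<^sup>+c. nexp (t i * num_points c (B i)) \<partial>P)"
      by (intro prod.cong refl) (simp add: L_def nn_integral_distr num_points_eq)
    also have "\<dots> = (\<Prod>i\<in>I. nexp ((1 - nexp (t i)) * emeasure M (B i)))"
      using has_poisson_laplaceD[OF P, of "{i}" B t for i] B(1)
      by (intro prod.cong refl) (simp add: disjoint_family_on_def)
    also have "\<dots> = (\<integral>\<^sup>+c. nexp (\<Sum>i\<in>I. t i * num_points c (B i)) \<partial>P)"
      by (subst has_poisson_laplaceD[OF P I B]) (simp_all add: nexp_sum)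
    finally show "(\<integral>\<^sup>+c. nexp (\<Sum>i\<in>I. t i * ennreal_of_enat (enat_points c (B i))) \<partial>P)
      = (\<integral>\<^sup>+\<omega>. nexp (\<Sum>i\<in>I. t i * ennreal_of_enat (\<omega> i)) \<partial>PiM I L)"
      by (simp add: num_points_eq)
  next
    fix i assume i: "i \<in> I"
    have "(\<lambda>\<omega>. \<omega> i) \<in> PiM I L \<rightarrow>\<^sub>M L i" using i by (rule measurable_component_singleton)
    then show "(\<lambda>\<omega>. \<omega> i) \<in> PiM I L \<rightarrow>\<^sub>M count_space UNIV" by (simp add: L_def)
  qed (auto intro: P.finite_measure_axioms Q.finite_measure_axioms)
  also have "{\<omega>\<in>space (PiM I L). \<forall>i\<in>I. \<omega> i = m i} = PiE I (\<lambda>i. {m i})"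
    by (auto simp: space_PiM PiE_iff L_def extensional_def)
  also have "emeasure (PiM I L) (PiE I (\<lambda>i. {m i})) = (\<Prod>i\<in>I. emeasure (L i) {m i})"
  proof -
    have "emeasure (PiM I L) (prod_emb I L I (PiE I (\<lambda>i. {m i}))) = (\<Prod>i\<in>I. emeasure (L i) {m i})"
      by (rule emeasure_PiM_emb) (use I L in \<open>auto simp: L_def\<close>)
    then show ?thesis by (subst (asm) prod_emb_PiE_same_index) (auto simp: L_def)
  qed
  also have "\<dots> = (\<Prod>i\<in>I. emeasure P {c\<in>collection_set M. enat_points c (B i) = m i})"
    by (intro prod.cong refl) (auto simp: L_def emeasure_distr space intro!: arg_cong[where f = "emeasure P"])
  finally show ?thesis by (simp add: space)
qed

text \<open>
  The mass at \<open>n\<close> of the Poisson law with parameter \<open>r\<close>; the law with parameter \<open>\<infinity>\<close> is concentrated at \<open>\<infinity>\<close>.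
\<close>

definition poisson_weight :: "ennreal \<Rightarrow> enat \<Rightarrow> ennreal" where
  "poisson_weight r n = (if r = \<infinity> then if n = \<infinity> then 1 else 0
     else case n of enat k \<Rightarrow> ennreal (enn2real r ^ k / fact k * exp (- enn2real r)) | \<infinity> \<Rightarrow> 0)"

lemma measurable_poisson_weight [measurable]: "(\<lambda>r. poisson_weight r n) \<in> borel_measurable borel"
  unfolding poisson_weight_def by (cases n) auto

lemma poisson_sums: "(\<lambda>n. r ^ n / fact n * exp (- r) * s ^ n) sums exp (- ((1 - s) * r))" for r s :: real
proof -
  have "(\<lambda>n. (r * s) ^ n /\<^sub>R fact n * exp (- r)) sums (exp (r * s) * exp (- r))"
    by (intro sums_mult2 exp_converges)
  then show ?thesis
    by (simp add: mult_exp_exp algebra_simps power_mult_distrib divide_inverse)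
qed

lemma emeasure_infinity_eq_0_if_poisson:
  fixes \<rho> :: "enat measure"
  assumes \<rho>: "prob_space \<rho>" "sets \<rho> = UNIV" and r: "0 \<le> r"
    and n: "\<And>n. measure \<rho> {enat n} = r ^ n / fact n * exp (- r)"
  shows "emeasure \<rho> {\<infinity>} = 0"
proof -
  interpret prob_space \<rho> by fact
  have "UNIV = space \<rho>" using \<rho>(2) sets.sets_into_space[of UNIV \<rho>] by auto
  then have 1: "1 = emeasure \<rho> {\<infinity>} + (\<Sum>n. emeasure \<rho> {enat n})"
    using emeasure_UNIV_enat[OF \<rho>(2)] emeasure_space_1 by simp
  have "(\<Sum>n. emeasure \<rho> {enat n}) = ennreal (\<Sum>n. r ^ n / fact n * exp (- r))"
    unfolding emeasure_eq_measure n
    using poisson_sums[of r 1] r by (intro suminf_ennreal2) (auto simp: sums_iff)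
  also have "(\<Sum>n. r ^ n / fact n * exp (- r)) = 1"
    using poisson_sums[of r 1] by (simp add: sums_iff)
  finally have "1 + emeasure \<rho> {\<infinity>} = 1 + 0" using 1 by (simp add: add.commute)
  then show ?thesis by (subst (asm) ennreal_add_left_cancel) simp
qed

lemma has_poisson_laplace_marginal:
  assumes P: "has_poisson_laplace M P" and B: "B \<in> sets M"
  shows "emeasure P {c\<in>collection_set M. enat_points c B = m} = poisson_weight (emeasure M B) m"
proof -
  have sets [measurable_cong]: "sets P = sets (collections M)"
    using P by (simp add: has_poisson_laplace_def)
  have space: "space P = collection_set M"
    using sets_eq_imp_space_eq[OF sets] by simp
  interpret P: prob_space P using P by (simp add: has_poisson_laplace_def)
  have X [measurable]: "(\<lambda>c. enat_points c B) \<in> P \<rightarrow>\<^sub>M count_space UNIV"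
    using B by measurable
  define \<rho> where "\<rho> = distr P (count_space UNIV) (\<lambda>c. enat_points c B)"
  interpret \<rho>: prob_space \<rho> unfolding \<rho>_def by (rule P.prob_space_distr) fact
  have sets\<rho>: "sets \<rho> = UNIV" by (simp add: \<rho>_def)
  have em: "emeasure P {c\<in>collection_set M. enat_points c B = m} = emeasure \<rho> {m}" for m
    by (auto simp: \<rho>_def emeasure_distr space intro!: arg_cong[where f = "emeasure P"])
  have lap: "(\<integral>\<^sup>+x. nexp (t * ennreal_of_enat x) \<partial>\<rho>) = nexp ((1 - nexp t) * emeasure M B)" for t
    using has_poisson_laplaceD[OF P, of "{0::nat}" "\<lambda>_. B" "\<lambda>_. t"] B
    by (simp add: disjoint_family_on_def \<rho>_def nn_integral_distr num_points_eq)
  show ?thesis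
  proof (cases "emeasure M B = \<infinity>")
    case True
    have "1 - nexp 1 = ennreal (1 - exp (- 1))"
      using nexp_ennreal[of 1] by (simp add: ennreal_minus flip: ennreal_1)
    then have "1 - nexp 1 \<noteq> 0" by (simp add: ennreal_eq_0_iff)
    then have "(\<integral>\<^sup>+x. nexp (1 * ennreal_of_enat x) \<partial>\<rho>) = 0"
      unfolding lap True by (simp add: ennreal_mult_top)
    then have "AE x in \<rho>. nexp (1 * ennreal_of_enat x) = 0"
      by (subst (asm) nn_integral_0_iff_AE) (auto simp: \<rho>_def)
    then have ae: "AE x in \<rho>. x = \<infinity>"
    proof (rule AE_mp, intro AE_I2 impI)
      fix x :: enat assume "nexp (1 * ennreal_of_enat x) = 0"
      then show "x = \<infinity>"
        by (cases x) (auto simp: nexp_def ennreal_of_nat_eq_real_of_nat split: if_splits)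
    qed
    have "emeasure \<rho> {x\<in>space \<rho>. x = m} = emeasure \<rho> {x\<in>space \<rho>. \<infinity> = m}"
    proof (rule emeasure_Collect_eq_AE)
      show "AE x in \<rho>. x = m \<longleftrightarrow> \<infinity> = m" using ae by eventually_elim auto
    qed (simp_all add: \<rho>_def)
    moreover have "space \<rho> = UNIV" by (simp add: \<rho>_def)
    ultimately have "emeasure \<rho> {m} = (if m = \<infinity> then 1 else 0)"
      using \<rho>.emeasure_space_1 by auto
    then show ?thesis by (simp add: em poisson_weight_def True)
  next
    case False
    define r where "r = enn2real (emeasure M B)"
    have r: "emeasure M B = ennreal r" "0 \<le> r" using False by (auto simp: r_def less_top)
    have n: "measure \<rho> {enat n} = r ^ n / fact n * exp (- r)" for n
    proof (rule powser_coeffs_unique)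
      fix s :: real assume s: "0 < s" "s < 1"
      show "(\<lambda>n. r ^ n / fact n * exp (- r) * s ^ n) sums exp (- ((1 - s) * r))"
        by (rule poisson_sums)
      have "nexp (ennreal (- ln s)) = ennreal s" using s by (simp add: nexp_ennreal)
      then have "(1 - nexp (ennreal (- ln s))) * emeasure M B = ennreal ((1 - s) * r)"
        using s r by (simp add: ennreal_mult ennreal_minus flip: ennreal_1)
      then have "(\<integral>\<^sup>+x. nexp (ennreal (- ln s) * ennreal_of_enat x) \<partial>\<rho>) = ennreal (exp (- ((1 - s) * r)))"
        using s r by (simp add: lap nexp_ennreal)
      then show "(\<lambda>n. measure \<rho> {enat n} * s ^ n) sums exp (- ((1 - s) * r))"
        using sums_measure_enat[OF \<rho>.finite_measure_axioms sets\<rho> s] by simp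
    qed
    show ?thesis
    proof (cases m)
      case (enat k)
      then show ?thesis using r n by (simp add: em poisson_weight_def \<rho>.emeasure_eq_measure)
    next
      case infinity
      then show ?thesis
        using emeasure_infinity_eq_0_if_poisson[OF \<rho>.prob_space_axioms sets\<rho> r(2) n] r
        by (simp add: em poisson_weight_def)
    qed
  qed
qed

lemma is_poisson_process_law_joint_counts:
  assumes P: "is_poisson_process_law M P" and I: "finite I"
    and B: "\<And>i. i \<in> I \<Longrightarrow> B i \<in> sets M" "disjoint_family_on B I"
  shows "emeasure P {c\<in>collection_set M. \<forall>i\<in>I. enat_points c (B i) = m i}
    = (\<Prod>i\<in>I. poisson_weight (emeasure M (B i)) (m i))"
proof -
  have sets [measurable_cong]: "sets P = sets (collections M)"
    using P by (simp add: is_poisson_process_law_def)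
  have space: "space P = collection_set M"
    using sets_eq_imp_space_eq[OF sets] by simp
  interpret P: prob_space P using P by (simp add: is_poisson_process_law_def)
  have marginal: "emeasure P {c\<in>collection_set M. enat_points c A = k} = poisson_weight (emeasure M A) k"
    if A: "A \<in> sets M" for A k
  proof -
    have X [measurable]: "(\<lambda>c. enat_points c A) \<in> P \<rightarrow>\<^sub>M count_space UNIV" using A by measurable
    define \<rho> where "\<rho> = distr P (count_space UNIV) (\<lambda>c. enat_points c A)"
    interpret \<rho>: prob_space \<rho> unfolding \<rho>_def by (rule P.prob_space_distr) fact
    have em: "emeasure P {c\<in>collection_set M. enat_points c A = k} = emeasure \<rho> {k}" for k
      by (auto simp: \<rho>_def emeasure_distr space intro!: arg_cong[where f = "emeasure P"])
    show ?thesis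
    proof (cases "emeasure M A = \<infinity>")
      case True
      with A have "AE c in P. num_points c A = \<infinity>"
        using P[unfolded is_poisson_process_law_def, THEN conjunct2, THEN conjunct2, THEN conjunct2, THEN conjunct1]
        by blast
      then have ae: "AE c in P. enat_points c A = \<infinity>"
        by (simp add: enat_points_eq_iff)
      have "emeasure P {c\<in>space P. enat_points c A = k} = emeasure P {c\<in>space P. \<infinity> = k}"
      proof (rule emeasure_Collect_eq_AE)
        show "AE c in P. enat_points c A = k \<longleftrightarrow> \<infinity> = k" using ae by eventually_elim auto
      qed measurable
      then show ?thesis
        using P.emeasure_space_1 unfolding space by (auto simp: poisson_weight_def True)
    next
      case False
      have n': "measure P {c\<in>space P. num_points c A = of_nat n} = measure M A ^ n / fact n * exp (- measure M A)" for n
        using P[unfolded is_poisson_process_law_def, THEN conjunct2, THEN conjunct2, THEN conjunct1] A False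
        by (simp add: less_top)
      have n: "measure \<rho> {enat n} = measure M A ^ n / fact n * exp (- measure M A)" for n
        using em[of "enat n"] n'[of n] by (simp add: enat_points_eq_iff space measure_def)
      show ?thesis
      proof (cases k)
        case (enat j)
        have "emeasure \<rho> {enat j} = ennreal (measure M A ^ j / fact j * exp (- measure M A))"
          by (simp add: \<rho>.emeasure_eq_measure n)
        then show ?thesis using enat False by (simp add: em poisson_weight_def measure_def)
      next
        case infinity
        have "emeasure \<rho> {\<infinity>} = 0"
          by (rule emeasure_infinity_eq_0_if_poisson[OF \<rho>.prob_space_axioms _ _ n]) (simp_all add: \<rho>_def)
        then show ?thesis using infinity False by (simp add: em poisson_weight_def)
      qed
    qed
  qed
  show ?thesis
  proof (cases "I = {}")
    case True
    then show ?thesis by (simp add: space[symmetric] P.emeasure_space_1)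
  next
    case False
    obtain h where h: "bij_betw h I {..<card I}"
      using ex_bij_betw_finite_nat[OF I] by (auto simp: atLeast0LessThan)
    define g where "g = the_inv_into I h"
    have g: "bij_betw g {..<card I} I" unfolding g_def by (rule bij_betw_the_inv_into) fact
    define A where "A n = (if n < card I then B (g n) else {})" for n
    have Ah: "A (h i) = B i" if "i \<in> I" for i
      using that h by (auto simp: A_def g_def bij_betw_def the_inv_into_f_f)
    have "range A \<subseteq> sets M" using B(1) g by (auto simp: A_def bij_betw_def)
    moreover have "disjoint_family A"
    proof (unfold disjoint_family_on_def, intro ballI impI)
      fix i j :: nat assume "i \<noteq> j"
      show "A i \<inter> A j = {}"
      proof (cases "i < card I \<and> j < card I")
        case True
        with g \<open>i \<noteq> j\<close> have "g i \<in> I" "g j \<in> I" "g i \<noteq> g j" by (auto simp: bij_betw_def inj_on_def)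
        with B(2) True show ?thesis by (auto simp: A_def disjoint_family_on_def)
      qed (auto simp: A_def)
    qed
    ultimately have "P.indep_vars (\<lambda>_. borel) (\<lambda>n c. num_points c (A n)) UNIV"
      using P by (simp add: is_poisson_process_law_def)
    then have "P.prob (\<Inter>n\<in>h ` I. (\<lambda>c. num_points c (A n)) -` {ennreal_of_enat (m (g n))} \<inter> space P)
        = (\<Prod>n\<in>h ` I. P.prob ((\<lambda>c. num_points c (A n)) -` {ennreal_of_enat (m (g n))} \<inter> space P))"
      by (rule P.indep_varsD) (use False I in simp_all)
    moreover have gh: "g (h i) = i" if "i \<in> I" for i
      using that h by (simp add: g_def bij_betw_def the_inv_into_f_f)
    have vim: "(\<lambda>c. num_points c (A (h i))) -` {ennreal_of_enat (m (g (h i)))} \<inter> space P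
        = {c\<in>collection_set M. enat_points c (B i) = m i}" if "i \<in> I" for i
      using that by (auto simp: space Ah gh num_points_eq)
    have "(\<Inter>n\<in>h ` I. (\<lambda>c. num_points c (A n)) -` {ennreal_of_enat (m (g n))} \<inter> space P)
        = (\<Inter>i\<in>I. {c\<in>collection_set M. enat_points c (B i) = m i})"
      unfolding image_image by (intro INF_cong refl vim)
    also have "\<dots> = {c\<in>collection_set M. \<forall>i\<in>I. enat_points c (B i) = m i}"
      using False by auto
    moreover have "(\<Prod>n\<in>h ` I. P.prob ((\<lambda>c. num_points c (A n)) -` {ennreal_of_enat (m (g n))} \<inter> space P))
        = (\<Prod>i\<in>I. P.prob {c\<in>collection_set M. enat_points c (B i) = m i})"
      using bij_betw_imp_inj_on[OF h] by (simp add: prod.reindex vim)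
    ultimately have "P.prob {c\<in>collection_set M. \<forall>i\<in>I. enat_points c (B i) = m i}
        = (\<Prod>i\<in>I. P.prob {c\<in>collection_set M. enat_points c (B i) = m i})"
      by simp
    then have "emeasure P {c\<in>collection_set M. \<forall>i\<in>I. enat_points c (B i) = m i}
        = (\<Prod>i\<in>I. emeasure P {c\<in>collection_set M. enat_points c (B i) = m i})"
      by (simp only: P.emeasure_eq_measure prod_ennreal measure_nonneg)
    also have "\<dots> = (\<Prod>i\<in>I. poisson_weight (emeasure M (B i)) (m i))"
      by (intro prod.cong refl marginal B(1))
    finally show ?thesis .
  qed
qed

lemma is_poisson_process_law_unique:
  assumes P: "is_poisson_process_law M P" and Q: "is_poisson_process_law M Q"
  shows "P = Q"
  using assms
  by (intro collections_measure_eqI[where M = M])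
     (auto simp: is_poisson_process_law_joint_counts[OF P] is_poisson_process_law_joint_counts[OF Q] is_poisson_process_law_def)

lemma has_poisson_laplace_imp_is_poisson:
  assumes P: "has_poisson_laplace M P"
  shows "is_poisson_process_law M P"
proof -
  have sets [measurable_cong]: "sets P = sets (collections M)"
    using P by (simp add: has_poisson_laplace_def)
  have space: "space P = collection_set M"
    using sets_eq_imp_space_eq[OF sets] by simp
  interpret P: prob_space P using P by (simp add: has_poisson_laplace_def)
  note marginal = has_poisson_laplace_marginal[OF P]
  have "measure P {c\<in>space P. num_points c A = of_nat n} = measure M A ^ n / fact n * exp (- measure M A)"
    if "A \<in> sets M" "emeasure M A < \<infinity>" for A n
    using marginal[OF that(1), of "enat n"] that(2)
    by (simp add: measure_def space enat_points_eq_iff poisson_weight_def less_top[symmetric])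
  moreover have "AE c in P. num_points c A = \<infinity>" if "A \<in> sets M" "emeasure M A = \<infinity>" for A
  proof -
    have "emeasure P {c\<in>space P. num_points c A = \<infinity>} = 1"
      using marginal[OF that(1), of \<infinity>] that by (simp add: space enat_points_eq_iff poisson_weight_def)
    moreover have "{c\<in>space P. num_points c A = \<infinity>} \<in> P.events"
      using that(1) by measurable
    ultimately have "AE c in P. c \<in> {c\<in>space P. num_points c A = \<infinity>}"
      by (simp add: P.emeasure_eq_measure P.prob_eq_1)
    then show ?thesis by simp
  qed
  moreover have "P.indep_vars (\<lambda>_. borel) (\<lambda>n c. num_points c (A n)) UNIV"
    if A: "range A \<subseteq> sets M" "disjoint_family A" for A :: "nat \<Rightarrow> 'a set"
  proof -
    have AM [measurable]: "A n \<in> sets M" for n using A by auto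
    \<comment> \<open>The empty set is included to make the generator closed under intersections.\<close>
    define G where "G n = insert {} {{c\<in>space P. enat_points c (A n) = k} | k. True}" for n
    have G: "P.indep_sets G UNIV"
    proof (rule P.indep_setsI)
      show "G n \<subseteq> P.events" for n unfolding G_def by auto
      fix E and J :: "nat set" assume J: "J \<noteq> {}" "finite J" and E: "\<forall>j\<in>J. E j \<in> G j"
      show "P.prob (\<Inter>j\<in>J. E j) = (\<Prod>j\<in>J. P.prob (E j))"
      proof (cases "\<exists>j\<in>J. E j = {}")
        case True
        then have "(\<Inter>j\<in>J. E j) = {}" by auto
        moreover have "(\<Prod>j\<in>J. P.prob (E j)) = 0"
        proof (rule prod_zero[OF J(2)])
          from True obtain j where "j \<in> J" "E j = {}" by blast
          then show "\<exists>j\<in>J. P.prob (E j) = 0" by (intro bexI[of _ j]) simp_all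
        qed
        ultimately show ?thesis by simp
      next
        case False
        with E have "\<forall>j\<in>J. \<exists>k. E j = {c\<in>space P. enat_points c (A j) = k}"
          by (auto simp: G_def)
        then obtain m where m: "\<And>j. j \<in> J \<Longrightarrow> E j = {c\<in>space P. enat_points c (A j) = m j}"
          by metis
        have "(\<Inter>j\<in>J. E j) = {c\<in>collection_set M. \<forall>j\<in>J. enat_points c (A j) = m j}"
          using J m by (auto simp: space)
        then have "emeasure P (\<Inter>j\<in>J. E j) = (\<Prod>j\<in>J. emeasure P (E j))"
          using has_poisson_laplace_indep[OF P J(2), of A m] A m
          by (simp add: space disjoint_family_on_def)
        then show ?thesis by (simp add: P.emeasure_eq_measure prod_ennreal prod_nonneg)
      qed
    qed
    have stable: "Int_stable (G n)" for n
      unfolding G_def by (intro Int_stableI) auto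
    show ?thesis
      unfolding P.indep_vars_def2
    proof (intro conjI ballI P.indep_sets_mono_sets[OF P.indep_sets_sigma[OF G stable]])
      fix n
      have "(\<lambda>c. num_points c (A n)) -` X \<inter> space P \<in> sigma_sets (space P) (G n)" for X
      proof -
        have "(\<lambda>c. num_points c (A n)) -` X \<inter> space P
            = (\<Union>k\<in>{k. ennreal_of_enat k \<in> X}. {c\<in>space P. enat_points c (A n) = k})"
          by (auto simp: num_points_eq)
        also have "\<dots> \<in> sigma_sets (space P) (G n)"
          by (rule sigma_sets_UNION) (auto simp: G_def intro!: sigma_sets.Basic)
        finally show ?thesis .
      qed
      then show "{(\<lambda>c. num_points c (A n)) -` X \<inter> space P |X. X \<in> sets borel} \<subseteq> sigma_sets (space P) (G n)"
        by auto
    qed measurable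
  qed
  ultimately show ?thesis
    unfolding is_poisson_process_law_def using sets P.prob_space_axioms by auto
qed

lemma poisson_process_law_eqI:
  assumes "has_poisson_laplace M P"
  shows "poisson_process_law M = P"
  unfolding poisson_process_law_def
  using has_poisson_laplace_imp_is_poisson[OF assms] is_poisson_process_law_unique by blast


section \<open>Existence of Poisson processes with s-finite intensity\<close>

lemma has_poisson_laplace_null:
  assumes "emeasure M (space M) = 0"
  shows "has_poisson_laplace M (return (collections M) (\<lambda>_. 0))"
  unfolding has_poisson_laplace_def
proof (intro conjI allI impI)
  have 0: "(\<lambda>_. 0) \<in> space (collections M)" by (simp add: collection_set_def)
  then show "prob_space (return (collections M) (\<lambda>_. 0))" by (rule prob_space_return)
  fix n :: nat and B :: "nat \<Rightarrow> 'a set" and t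
  assume B: "\<forall>i<n. B i \<in> sets M"
  then have [measurable]: "i < n \<Longrightarrow> B i \<in> sets M" for i by simp
  have "emeasure M (B i) = 0" if "i < n" for i
    using emeasure_space[of M "B i"] assms by simp
  moreover have "(\<lambda>c. nexp (\<Sum>i<n. t i * num_points c (B i))) \<in> borel_measurable (collections M)"
    by measurable
  ultimately show "(\<integral>\<^sup>+c. nexp (\<Sum>i<n. t i * num_points c (B i)) \<partial>return (collections M) (\<lambda>_. 0))
      = nexp (\<Sum>i<n. (1 - nexp (t i)) * emeasure M (B i))"
    using 0 by (simp add: nn_integral_return num_points_def)
qed simp

text \<open>
  The collection consisting of the first \<open>k\<close> entries of a sequence, with multiplicities.
\<close>

definition points :: "nat \<Rightarrow> (nat \<Rightarrow> 'a) \<Rightarrow> 'a \<Rightarrow> enat" where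
  "points k x a = enat (card {j\<in>{..<k}. x j = a})"

lemma num_points_points: "num_points (points k x) A = (\<Sum>j<k. indicator A (x j))"
proof -
  have "ennreal_of_enat (points k x a) = (\<Sum>j<k. indicator {x j} a)" for a
  proof -
    have "(\<Sum>j\<in>{j\<in>{..<k}. x j = a}. 1 :: ennreal) = (\<Sum>j<k. if x j = a then 1 else 0)"
      by (rule sum.inter_filter) simp
    also have "\<dots> = (\<Sum>j<k. indicator {x j} a)"
      by (intro sum.cong) (auto simp: indicator_def)
    finally have "(\<Sum>j<k. indicator {x j} a :: ennreal) = (\<Sum>j\<in>{j\<in>{..<k}. x j = a}. 1)" ..
    then show ?thesis by (simp add: points_def)
  qed
  then have "num_points (points k x) A = (\<integral>\<^sup>+a. (\<Sum>j<k. indicator A a * indicator {x j} a) \<partial>count_space UNIV)"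
    by (simp add: num_points_UNIV sum_distrib_left)
  also have "\<dots> = (\<Sum>j<k. \<integral>\<^sup>+a. indicator A a * indicator {x j} a \<partial>count_space UNIV)"
    by (rule nn_integral_sum) simp
  also have "\<dots> = (\<Sum>j<k. indicator A (x j))"
  proof (rule sum.cong[OF refl])
    fix j
    have "(\<integral>\<^sup>+a. indicator A a * indicator {x j} a \<partial>count_space UNIV)
        = (\<Sum>a\<in>{x j}. indicator A a * indicator {x j} a :: ennreal)"
      by (rule nn_integral_count_space') auto
    then show "(\<integral>\<^sup>+a. indicator A a * indicator {x j} a \<partial>count_space UNIV) = (indicator A (x j) :: ennreal)"
      by simp
  qed
  finally show ?thesis .
qed

lemma points_in_collection_set:
  assumes "\<And>j. j < k \<Longrightarrow> x j \<in> space M"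
  shows "points k x \<in> collection_set M"
proof -
  have "{a. points k x a \<noteq> 0} \<subseteq> x ` {..<k}"
    by (auto simp: points_def enat_0_iff card_eq_0_iff)
  moreover have "countable (x ` {..<k})" by (intro countable_finite) auto
  ultimately show ?thesis
    using assms by (auto simp: collection_set_def intro: countable_subset)
qed

lemma measurable_points [measurable]: "points k \<in> PiM {..<k} (\<lambda>_. M) \<rightarrow>\<^sub>M collections M"
proof (rule measurable_collectionsI)
  fix A assume [measurable]: "A \<in> sets M"
  show "(\<lambda>x. num_points (points k x) A) \<in> borel_measurable (PiM {..<k} (\<lambda>_. M))"
    unfolding num_points_points by measurable
qed (auto intro!: points_in_collection_set simp: space_PiM)

lemma nn_integral_poisson_pmf_power:
  assumes r: "0 < r" and q: "0 \<le> q" "q \<le> 1"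
  shows "(\<integral>\<^sup>+k. ennreal q ^ k \<partial>measure_pmf (poisson_pmf r)) = nexp (ennreal (r * (1 - q)))"
proof -
  have "(\<integral>\<^sup>+k. ennreal q ^ k \<partial>measure_pmf (poisson_pmf r)) = (\<Sum>k. ennreal (r ^ k / fact k * exp (- r) * q ^ k))"
  proof -
    have "ennreal (pmf (poisson_pmf r) k) * ennreal q ^ k = ennreal (r ^ k / fact k * exp (- r) * q ^ k)" for k
      unfolding ennreal_power[OF q(1)] pmf_poisson[OF r]
      by (rule ennreal_mult[symmetric]) (use r q in auto)
    then show ?thesis
      by (simp only: nn_integral_measure_pmf nn_integral_count_space_nat)
  qed
  also have "\<dots> = ennreal (exp (- ((1 - q) * r)))"
    using poisson_sums[of r q] r q by (subst suminf_ennreal2) (auto simp: sums_iff)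
  also have "\<dots> = nexp (ennreal (r * (1 - q)))"
    using r q by (simp add: nexp_ennreal mult.commute)
  finally show ?thesis .
qed

lemma sum_indicator_disjoint_cases:
  assumes B: "disjoint_family_on B I" and I: "finite I"
  obtains i where "i \<in> I" "\<And>f :: 'i \<Rightarrow> ennreal. (\<Sum>j\<in>I. f j * indicator (B j) a) = f i"
  | "\<And>f :: 'i \<Rightarrow> ennreal. (\<Sum>j\<in>I. f j * indicator (B j) a) = 0"
proof (cases "\<exists>i\<in>I. a \<in> B i")
  case True
  then obtain i where i: "i \<in> I" "a \<in> B i" by blast
  have "a \<notin> B j" if "j \<in> I" "j \<noteq> i" for j
    using B i that by (auto simp: disjoint_family_on_def)
  then have "(\<Sum>j\<in>I. f j * indicator (B j) a) = f i" for f :: "'i \<Rightarrow> ennreal"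
    using I i by (subst sum.remove[of I i]) (auto intro!: sum.neutral)
  with i(1) show thesis by (rule that(1))
next
  case False
  then have "(\<Sum>j\<in>I. f j * indicator (B j) a) = 0" for f :: "'i \<Rightarrow> ennreal"
    by (intro sum.neutral) auto
  then show thesis by (rule that(2))
qed

lemma nexp_sum_indicator:
  assumes "disjoint_family_on B I" "finite I"
  shows "nexp (\<Sum>i\<in>I. t i * indicator (B i) a) + (\<Sum>i\<in>I. (1 - nexp (t i)) * indicator (B i) a) = 1"
  by (rule sum_indicator_disjoint_cases[OF assms, of a])
     (simp_all only: nexp_0 add_diff_inverse_ennreal nexp_le_1 add_0_right)

text \<open>
  For a finite intensity that is not null, a Poisson number of independent points with the normalised law.
\<close>

lemma has_poisson_laplace_finite:
  assumes fin: "finite_measure M" and pos: "emeasure M (space M) \<noteq> 0"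
  defines "P \<equiv> measure_pmf (poisson_pmf (measure M (space M))) \<bind>
      (\<lambda>k. distr (PiM {..<k} (\<lambda>_. uniform_measure M (space M))) (collections M) (points k))"
  shows "has_poisson_laplace M P"
proof -
  interpret M: finite_measure M by fact
  define r where "r = measure M (space M)"
  have r: "0 < r" "emeasure M (space M) = ennreal r"
    using pos by (auto simp: r_def M.emeasure_eq_measure zero_less_measure_iff)
  define \<nu> where "\<nu> = uniform_measure M (space M)"
  interpret \<nu>: prob_space \<nu>
    unfolding \<nu>_def using pos by (intro prob_space_uniform_measure) auto
  have sets\<nu> [measurable_cong]: "sets \<nu> = sets M" by (simp add: \<nu>_def)
  define D where [abs_def]: "D k = distr (PiM {..<k} (\<lambda>_. \<nu>)) (collections M) (points k)" for k
  have pts [measurable]: "points k \<in> PiM {..<k} (\<lambda>_. \<nu>) \<rightarrow>\<^sub>M collections M" for k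
    using measurable_points[of k \<nu>] collections_cong[OF sets\<nu>] by simp
  have PiM: "prob_space (PiM {..<k} (\<lambda>_. \<nu>))" for k :: nat
    by (rule prob_space_PiM) (rule \<nu>.prob_space_axioms)
  have D: "prob_space (D k)" for k
    unfolding D_def by (rule prob_space.prob_space_distr[OF PiM pts])
  have D_meas: "D \<in> measure_pmf (poisson_pmf r) \<rightarrow>\<^sub>M prob_algebra (collections M)"
    using D by (auto simp: measurable_def space_prob_algebra D_def)
  have D_meas': "D \<in> measure_pmf (poisson_pmf r) \<rightarrow>\<^sub>M subprob_algebra (collections M)"
    using D_meas by (rule measurable_prob_algebraD)
  have P: "P = measure_pmf (poisson_pmf r) \<bind> D"
    unfolding P_def D_def \<nu>_def r_def ..
  have pmf: "measure_pmf (poisson_pmf r) \<in> space (prob_algebra (measure_pmf (poisson_pmf r)))"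
    by (simp add: space_prob_algebra prob_space_measure_pmf)
  show ?thesis
    unfolding has_poisson_laplace_def
  proof (intro conjI allI impI)
    show "prob_space P" unfolding P by (rule prob_space_bind'[OF pmf D_meas])
    show "sets P = sets (collections M)" unfolding P by (rule sets_bind'[OF pmf D_meas])
    fix n :: nat and B :: "nat \<Rightarrow> 'a set" and t :: "nat \<Rightarrow> ennreal"
    assume B: "\<forall>i<n. B i \<in> sets M" "disjoint_family_on B {..<n}"
    then have [measurable]: "i < n \<Longrightarrow> B i \<in> sets M" for i by simp
    \<comment> \<open>A random point multiplies the Laplace functional by \<open>q\<close> on average, and \<open>q = 1 - w\<close> because the \<open>B i\<close> are disjoint.\<close>
    define g where "g a = (\<Sum>i<n. t i * indicator (B i) a)" for a
    have g [measurable]: "g \<in> borel_measurable M" unfolding g_def by measurable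
    define q where "q = (\<integral>\<^sup>+a. nexp (g a) \<partial>\<nu>)"
    define w where "w = (\<Sum>i<n. (1 - nexp (t i)) * emeasure \<nu> (B i))"
    have w: "w = (\<integral>\<^sup>+a. (\<Sum>i<n. (1 - nexp (t i)) * indicator (B i) a) \<partial>\<nu>)"
      unfolding w_def by (subst nn_integral_sum) (simp_all add: nn_integral_cmult_indicator)
    have "q + w = (\<integral>\<^sup>+a. nexp (g a) + (\<Sum>i<n. (1 - nexp (t i)) * indicator (B i) a) \<partial>\<nu>)"
      unfolding q_def w by (rule nn_integral_add[symmetric]) measurable
    also have "\<dots> = 1"
      unfolding g_def using nexp_sum_indicator[OF B(2)] by (simp add: \<nu>.emeasure_space_1)
    finally have qw: "q + w = 1" .
    then have "q \<le> 1" "w \<le> 1" by (metis le_iff_add, metis add.commute le_iff_add)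
    then obtain q' w' where q': "q = ennreal q'" "0 \<le> q'" "w = ennreal w'" "0 \<le> w'"
      by (metis ennreal_cases ennreal_one_neq_top top_unique)
    with qw have w': "w' = 1 - q'" by (simp flip: ennreal_plus ennreal_1)
    have lap: "(\<integral>\<^sup>+c. nexp (\<Sum>i<n. t i * num_points c (B i)) \<partial>D k) = q ^ k" for k
    proof -
      have "(\<Sum>i<n. t i * num_points (points k x) (B i)) = (\<Sum>j<k. g (x j))" for x
        unfolding num_points_points g_def sum_distrib_left by (rule sum.swap)
      then have "(\<integral>\<^sup>+c. nexp (\<Sum>i<n. t i * num_points c (B i)) \<partial>D k)
          = (\<integral>\<^sup>+x. (\<Prod>j<k. nexp (g (x j))) \<partial>PiM {..<k} (\<lambda>_. \<nu>))"
        unfolding D_def by (subst nn_integral_distr) (simp_all add: nexp_sum)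
      also have "\<dots> = (\<Prod>j<k. q)"
        unfolding q_def by (rule nn_integral_PiM_prod) (auto intro: \<nu>.prob_space_axioms)
      finally show ?thesis by simp
    qed
    have "(\<integral>\<^sup>+c. nexp (\<Sum>i<n. t i * num_points c (B i)) \<partial>P)
        = (\<integral>\<^sup>+k. q ^ k \<partial>measure_pmf (poisson_pmf r))"
      unfolding P by (subst nn_integral_bind[OF _ D_meas']) (simp_all add: lap)
    also have "\<dots> = nexp (ennreal r * w)"
      using q' w' r by (simp add: nn_integral_poisson_pmf_power ennreal_mult)
    also have "ennreal r * w = (\<Sum>i<n. (1 - nexp (t i)) * emeasure M (B i))"
    proof -
      have "ennreal r * emeasure \<nu> (B i) = emeasure M (B i)" if "i < n" for i
      proof -
        have "B i \<in> sets M" using B that by simp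
        then have "emeasure \<nu> (B i) = emeasure M (B i) / ennreal r"
          using sets.sets_into_space by (simp add: \<nu>_def r Int_absorb1)
        then have "ennreal r * emeasure \<nu> (B i) = emeasure M (B i) * ennreal r / ennreal r"
          by (simp add: ennreal_times_divide mult.commute)
        also have "\<dots> = emeasure M (B i)"
          using r by (intro ennreal_mult_divide_eq) auto
        finally show ?thesis .
      qed
      then show ?thesis
        unfolding w_def sum_distrib_left by (intro sum.cong) (simp_all add: mult.left_commute[of "ennreal r"])
    qed
    finally show "(\<integral>\<^sup>+c. nexp (\<Sum>i<n. t i * num_points c (B i)) \<partial>P)
        = nexp (\<Sum>i<n. (1 - nexp (t i)) * emeasure M (B i))" .
  qed
qed

text \<open>
  The union, with multiplicities, of a sequence of collections. The supremum of partial sums is their infinite sum.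
\<close>

definition superpose :: "(nat \<Rightarrow> 'a \<Rightarrow> enat) \<Rightarrow> 'a \<Rightarrow> enat" where
  "superpose \<omega> a = (SUP k. \<Sum>n<k. \<omega> n a)"

lemma num_points_superpose: "num_points (superpose \<omega>) A = (\<Sum>n. num_points (\<omega> n) A)"
proof -
  have "ennreal_of_enat (superpose \<omega> a) = (\<Sum>n. ennreal_of_enat (\<omega> n a))" for a
    unfolding superpose_def suminf_eq_SUP
    by (simp add: ennreal_of_enat_Sup image_image)
  then show ?thesis
    unfolding num_points_def by (simp add: nn_integral_suminf)
qed

lemma superpose_in_collection_set:
  assumes "\<And>n. \<omega> n \<in> collection_set M"
  shows "superpose \<omega> \<in> collection_set M"
proof -
  have "{a. superpose \<omega> a \<noteq> 0} \<subseteq> (\<Union>n. {a. \<omega> n a \<noteq> 0})"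
  proof clarify
    fix a assume "superpose \<omega> a \<noteq> 0"
    show "a \<in> (\<Union>n. {a. \<omega> n a \<noteq> 0})"
    proof (rule ccontr)
      assume "a \<notin> (\<Union>n. {a. \<omega> n a \<noteq> 0})"
      then have "superpose \<omega> a = 0" by (simp add: superpose_def)
      with \<open>superpose \<omega> a \<noteq> 0\<close> show False by simp
    qed
  qed
  moreover have "countable (\<Union>n. {a. \<omega> n a \<noteq> 0})" "(\<Union>n. {a. \<omega> n a \<noteq> 0}) \<subseteq> space M"
    using assms by (auto simp: collection_set_def)
  ultimately show ?thesis
    by (auto simp: collection_set_def intro: countable_subset)
qed

lemma measurable_superpose [measurable]: "superpose \<in> PiM UNIV (\<lambda>_. collections M) \<rightarrow>\<^sub>M collections M"
proof (rule measurable_collectionsI)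
  fix A assume [measurable]: "A \<in> sets M"
  show "(\<lambda>\<omega>. num_points (superpose \<omega>) A) \<in> borel_measurable (PiM UNIV (\<lambda>_. collections M))"
    unfolding num_points_superpose by measurable
qed (auto intro!: superpose_in_collection_set simp: space_PiM)

lemma has_poisson_laplace_superpose:
  assumes sets: "\<And>n. sets (M' n) = sets M"
    and em: "\<And>A. A \<in> sets M \<Longrightarrow> emeasure M A = (\<Sum>n. emeasure (M' n) A)"
    and P: "\<And>n. has_poisson_laplace (M' n) (P n)"
  shows "has_poisson_laplace M (distr (PiM UNIV P) (collections M) superpose)"
proof -
  have Pn: "prob_space (P n)" for n using P by (simp add: has_poisson_laplace_def)
  have setsP: "sets (P n) = sets (collections M)" for n
    using P[of n] collections_cong[OF sets] by (simp add: has_poisson_laplace_def)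
  have sup [measurable]: "superpose \<in> PiM UNIV P \<rightarrow>\<^sub>M collections M"
    using measurable_superpose by (simp add: measurable_cong_sets[OF sets_PiM_cong[OF refl setsP] refl])
  interpret PiM: prob_space "PiM UNIV P" by (rule prob_space_PiM) (rule Pn)
  show ?thesis
    unfolding has_poisson_laplace_def
  proof (intro conjI allI impI)
    show "prob_space (distr (PiM UNIV P) (collections M) superpose)"
      by (rule PiM.prob_space_distr) (rule sup)
    fix n :: nat and B :: "nat \<Rightarrow> 'a set" and t :: "nat \<Rightarrow> ennreal"
    assume B: "\<forall>i<n. B i \<in> sets M" "disjoint_family_on B {..<n}"
    then have [measurable]: "i < n \<Longrightarrow> B i \<in> sets M" for i by simp
    have meas: "(\<lambda>c. \<Sum>i<n. t i * num_points c (B i)) \<in> borel_measurable (collections M)"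
      by measurable
    have "(\<integral>\<^sup>+c. nexp (\<Sum>i<n. t i * num_points c (B i)) \<partial>distr (PiM UNIV P) (collections M) superpose)
      = (\<integral>\<^sup>+\<omega>. nexp (\<Sum>i<n. t i * num_points (superpose \<omega>) (B i)) \<partial>PiM UNIV P)"
      by (subst nn_integral_distr) simp_all
    also have "\<dots> = (\<integral>\<^sup>+\<omega>. nexp (\<integral>\<^sup>+k. (\<Sum>i<n. t i * num_points (\<omega> k) (B i)) \<partial>count_space UNIV) \<partial>PiM UNIV P)"
      unfolding num_points_superpose nn_integral_count_space_nat[symmetric]
      by (subst nn_integral_sum) (simp_all add: nn_integral_cmult)
    also have "\<dots> = nexp (\<integral>\<^sup>+k. (\<Sum>i<n. (1 - nexp (t i)) * emeasure (M' k) (B i)) \<partial>count_space UNIV)"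
    proof (rule nn_integral_PiM_nexp)
      fix k
      show "(\<lambda>c. \<Sum>i<n. t i * num_points c (B i)) \<in> borel_measurable (P k)"
        using meas measurable_cong_sets[OF setsP refl] by blast
      show "(\<integral>\<^sup>+c. nexp (\<Sum>i<n. t i * num_points c (B i)) \<partial>P k) = nexp (\<Sum>i<n. (1 - nexp (t i)) * emeasure (M' k) (B i))"
        by (rule has_poisson_laplaceD[OF P]) (use B sets in auto)
    qed (auto intro: Pn)
    also have "(\<integral>\<^sup>+k. (\<Sum>i<n. (1 - nexp (t i)) * emeasure (M' k) (B i)) \<partial>count_space UNIV)
      = (\<Sum>i<n. (1 - nexp (t i)) * (\<integral>\<^sup>+k. emeasure (M' k) (B i) \<partial>count_space UNIV))"
      by (subst nn_integral_sum) (simp_all add: nn_integral_cmult)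
    also have "\<dots> = (\<Sum>i<n. (1 - nexp (t i)) * emeasure M (B i))"
      using B by (intro sum.cong) (simp_all add: nn_integral_count_space_nat em)
    finally show "(\<integral>\<^sup>+c. nexp (\<Sum>i<n. t i * num_points c (B i)) \<partial>distr (PiM UNIV P) (collections M) superpose)
      = nexp (\<Sum>i<n. (1 - nexp (t i)) * emeasure M (B i))" .
  qed simp
qed

text \<open>
  A countable sum of finite measures. This property is preserved by images, unlike sigma-finiteness, and it is
  enough for the existence of a Poisson process.
\<close>

definition s_finite_measure :: "'a measure \<Rightarrow> bool" where
  "s_finite_measure M \<longleftrightarrow> (\<exists>M' :: nat \<Rightarrow> 'a measure. \<forall>n. finite_measure (M' n) \<and> sets (M' n) = sets M \<and>
     (\<forall>A\<in>sets M. emeasure M A = (\<Sum>n. emeasure (M' n) A)))"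

theorem has_poisson_laplace_poisson_process_law:
  assumes "s_finite_measure M"
  shows "has_poisson_laplace M (poisson_process_law M)"
proof -
  obtain M' :: "nat \<Rightarrow> 'a measure" where M': "\<And>n. finite_measure (M' n)" "\<And>n. sets (M' n) = sets M"
      "\<And>A. A \<in> sets M \<Longrightarrow> emeasure M A = (\<Sum>n. emeasure (M' n) A)"
    using assms unfolding s_finite_measure_def by metis
  have "\<exists>P. has_poisson_laplace (M' n) P" for n
    using has_poisson_laplace_null[of "M' n"] has_poisson_laplace_finite[OF M'(1)[of n]] by blast
  then obtain P where "\<And>n. has_poisson_laplace (M' n) (P n)" by metis
  from has_poisson_laplace_superpose[OF M'(2,3) this] show ?thesis
    by (simp add: poisson_process_law_eqI)
qed

section \<open>Independent thinning\<close>

lemma countable_copies: "c \<in> collection_set M \<Longrightarrow> countable (copies c)"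
  by (rule countable_subset[of _ "{a. c a \<noteq> 0} \<times> UNIV"])
     (auto simp: copies_def collection_set_def)

lemma kept_True: "kept c (\<lambda>_. True) = c"
proof
  fix a
  show "kept c (\<lambda>_. True) a = c a"
  proof (cases "c a")
    case (enat k)
    then have "{n. enat n < c a} = {..<k}" by auto
    with enat show ?thesis by (simp add: kept_def copies_def)
  next
    case infinity
    then show ?thesis by (simp add: kept_def copies_def)
  qed
qed

lemma num_points_kept:
  "num_points (kept c b) A = (\<integral>\<^sup>+j. indicator A (fst j) * of_bool (b j) \<partial>count_space (copies c))"
proof -
  have "ennreal_of_enat (kept c b a) = (\<integral>\<^sup>+n. of_bool ((a, n) \<in> copies c \<and> b (a, n)) \<partial>count_space UNIV)" for a
  proof -
    define S where "S = {n. (a, n) \<in> copies c \<and> b (a, n)}"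
    have "(\<integral>\<^sup>+n. of_bool ((a, n) \<in> copies c \<and> b (a, n)) \<partial>count_space UNIV) = (\<integral>\<^sup>+n. indicator S n \<partial>count_space UNIV)"
      by (intro nn_integral_cong) (auto simp: S_def)
    also have "\<dots> = emeasure (count_space UNIV) S" by simp
    also have "\<dots> = ennreal_of_enat (kept c b a)"
      by (simp add: kept_def S_def[symmetric] emeasure_count_space)
    finally show ?thesis ..
  qed
  then have "num_points (kept c b) A
      = (\<integral>\<^sup>+a. \<integral>\<^sup>+n. indicator A a * of_bool ((a, n) \<in> copies c \<and> b (a, n)) \<partial>count_space UNIV \<partial>count_space UNIV)"
    by (simp add: num_points_UNIV nn_integral_cmult)
  also have "\<dots> = (\<integral>\<^sup>+j. indicator A (fst j) * of_bool (j \<in> copies c \<and> b j) \<partial>count_space UNIV)"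
    using nn_integral_fst_count_space[of "\<lambda>j. indicator A (fst j) * of_bool (j \<in> copies c \<and> b j)"] by simp
  also have "\<dots> = (\<integral>\<^sup>+j. indicator A (fst j) * of_bool (b j) \<partial>count_space (copies c))"
    by (subst nn_integral_count_space_indicator) (auto intro!: nn_integral_cong split: split_indicator)
  finally show ?thesis .
qed

lemma kept_in_collection_set:
  assumes "c \<in> collection_set M"
  shows "kept c b \<in> collection_set M"
proof -
  have "{a. kept c b a \<noteq> 0} \<subseteq> {a. c a \<noteq> 0}"
    by (auto simp: kept_def copies_def enat_0_iff)
  with assms show ?thesis
    by (auto simp: collection_set_def intro: countable_subset)
qed

lemma measurable_kept [measurable]:
  assumes c: "c \<in> collection_set M"
  shows "kept c \<in> PiM (copies c) (\<lambda>_. measure_pmf (bernoulli_pmf p)) \<rightarrow>\<^sub>M collections M"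
proof (rule measurable_collectionsI)
  fix A
  have "(\<lambda>b. indicator A (fst j) * of_bool (b j) :: ennreal) \<in> borel_measurable (PiM (copies c) (\<lambda>_. measure_pmf (bernoulli_pmf p)))"
    if "j \<in> copies c" for j
    by (rule measurable_compose[OF measurable_component_singleton[OF that]]) simp
  then show "(\<lambda>b. num_points (kept c b) A) \<in> borel_measurable (PiM (copies c) (\<lambda>_. measure_pmf (bernoulli_pmf p)))"
    unfolding num_points_kept
    by (intro borel_measurable_nn_integral_count_space countable_copies[OF c])
qed (rule kept_in_collection_set[OF c])

lemma prob_space_thinning:
  assumes "c \<in> collection_set M"
  shows "prob_space (thinning M p c)"
  unfolding thinning_def
  by (intro prob_space.prob_space_distr prob_space_PiM prob_space_measure_pmf measurable_kept assms)

lemma sets_thinning [simp, measurable_cong]: "sets (thinning M p c) = sets (collections M)"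
  by (simp add: thinning_def)

text \<open>
  A kept point contributes \<open>nexp t\<close> with probability \<open>p\<close> and a discarded one contributes \<open>1\<close>. Thinning therefore
  replaces the exponents \<open>t i\<close> by the \<open>s i\<close> with \<open>nexp (s i) = p * nexp (t i) + 1 - p\<close>.
\<close>

lemma thinning_laplace:
  assumes p: "0 \<le> p" "p \<le> 1" and c: "c \<in> collection_set M"
    and I: "finite I" and B: "\<And>i. i \<in> I \<Longrightarrow> B i \<in> sets M" "disjoint_family_on B I"
    and s: "\<And>i. i \<in> I \<Longrightarrow> nexp (s i) = nexp (t i) * ennreal p + ennreal (1 - p)"
  shows "(\<integral>\<^sup>+c'. nexp (\<Sum>i\<in>I. t i * num_points c' (B i)) \<partial>thinning M p c)
    = nexp (\<Sum>i\<in>I. s i * num_points c (B i))"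
proof -
  note [measurable] = B(1) measurable_kept[OF c]
  have kept: "(\<Sum>i\<in>I. r i * num_points (kept c b) (B i))
      = (\<integral>\<^sup>+j. (\<Sum>i\<in>I. r i * indicator (B i) (fst j)) * of_bool (b j) \<partial>count_space (copies c))" for r b
    unfolding num_points_kept sum_distrib_right mult.assoc
    by (subst nn_integral_sum) (simp_all add: nn_integral_cmult)
  have "(\<integral>\<^sup>+c'. nexp (\<Sum>i\<in>I. t i * num_points c' (B i)) \<partial>thinning M p c)
      = (\<integral>\<^sup>+b. nexp (\<Sum>i\<in>I. t i * num_points (kept c b) (B i)) \<partial>PiM (copies c) (\<lambda>_. measure_pmf (bernoulli_pmf p)))"
    unfolding thinning_def by (subst nn_integral_distr) simp_all
  also have "\<dots> = nexp (\<integral>\<^sup>+j. (\<Sum>i\<in>I. s i * indicator (B i) (fst j)) \<partial>count_space (copies c))"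
    unfolding kept
  proof (rule nn_integral_PiM_nexp[OF countable_copies[OF c] prob_space_measure_pmf])
    fix j assume "j \<in> copies c"
    have 1: "nexp (\<Sum>i\<in>I. s i * indicator (B i) (fst j))
        = nexp (\<Sum>i\<in>I. t i * indicator (B i) (fst j)) * ennreal p + ennreal (1 - p)"
    proof (rule sum_indicator_disjoint_cases[OF B(2) I, of "fst j"])
      fix i assume "i \<in> I" "\<And>f :: 'b \<Rightarrow> ennreal. (\<Sum>k\<in>I. f k * indicator (B k) (fst j)) = f i"
      then show ?thesis using s by (simp only:)
    next
      assume *: "\<And>f :: 'b \<Rightarrow> ennreal. (\<Sum>k\<in>I. f k * indicator (B k) (fst j)) = 0"
      show ?thesis unfolding * using p by (simp flip: ennreal_plus)
    qed
    show "(\<integral>\<^sup>+x. nexp ((\<Sum>i\<in>I. t i * indicator (B i) (fst j)) * of_bool x) \<partial>measure_pmf (bernoulli_pmf p))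
        = nexp (\<Sum>i\<in>I. s i * indicator (B i) (fst j))"
      unfolding 1 by (subst nn_integral_bernoulli_pmf) (use p in simp_all)
  qed simp
  also have "(\<integral>\<^sup>+j. (\<Sum>i\<in>I. s i * indicator (B i) (fst j)) \<partial>count_space (copies c)) = (\<Sum>i\<in>I. s i * num_points c (B i))"
    using kept[of s "\<lambda>_. True"] by (simp add: kept_True)
  finally show ?thesis .
qed

lemma thinning_exponent:
  assumes p: "0 \<le> p" "p \<le> 1"
  obtains s where "\<And>t. nexp (s t) = nexp t * ennreal p + ennreal (1 - p)"
proof -
  have "\<exists>s. nexp s = nexp t * ennreal p + ennreal (1 - p)" for t
  proof -
    have "nexp t * ennreal p + ennreal (1 - p) \<le> 1 * ennreal p + ennreal (1 - p)"
      by (intro add_right_mono mult_right_mono nexp_le_1) simp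
    also have "\<dots> = 1" using p by (simp flip: ennreal_plus)
    finally show ?thesis by (metis nexp_surj)
  qed
  then show thesis using that by metis
qed

text \<open>
  By the Laplace functional, the joint law of the counts of the thinned collection in disjoint sets depends on the
  original collection only through its counts in the same sets. These take countably many values, so every function of
  them is measurable.
\<close>

lemma measurable_thinning:
  assumes p: "0 \<le> p" "p \<le> 1"
  shows "thinning M p \<in> collections M \<rightarrow>\<^sub>M prob_algebra (collections M)"
proof (rule measurable_collections_kernel)
  fix I :: "'a set set set" and B :: "'a set set \<Rightarrow> 'a set" and m
  assume I: "finite I" and B: "\<And>i. i \<in> I \<Longrightarrow> B i \<in> sets M" "disjoint_family_on B I"
  note [measurable] = B(1)
  define X where "X c = (\<lambda>i\<in>I. enat_points c (B i))" for c
  define E where "E = {c\<in>collection_set M. \<forall>i\<in>I. enat_points c (B i) = m i}"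
  have count: "countable (I \<rightarrow>\<^sub>E (UNIV :: enat set))" using I by (intro countable_PiE) auto
  have X: "X \<in> collections M \<rightarrow>\<^sub>M count_space (I \<rightarrow>\<^sub>E UNIV)"
    unfolding measurable_count_space_eq_countable[OF count]
  proof (intro conjI ballI)
    fix k assume k: "k \<in> I \<rightarrow>\<^sub>E (UNIV :: enat set)"
    have "X -` {k} \<inter> space (collections M) = {c\<in>space (collections M). \<forall>i\<in>I. enat_points c (B i) = k i}"
      using k by (auto simp: X_def fun_eq_iff PiE_iff extensional_def)
    also have "\<dots> \<in> sets (collections M)"
      using I by (intro sets.sets_Collect_finite_All sets_enat_points_eq B) auto
    finally show "X -` {k} \<inter> space (collections M) \<in> sets (collections M)" .
  qed (auto simp: X_def)
  have eq: "emeasure (thinning M p c) E = emeasure (thinning M p c') E"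
    if c: "c \<in> collection_set M" "c' \<in> collection_set M" and X: "X c = X c'" for c c'
  proof -
    have num: "num_points c (B i) = num_points c' (B i)" if "i \<in> I" for i
      using X that by (metis X_def num_points_eq restrict_apply')
    obtain s where s: "\<And>t. nexp (s t) = nexp t * ennreal p + ennreal (1 - p)"
      using thinning_exponent[OF p] by blast
    have "emeasure (thinning M p c) {c''\<in>space (thinning M p c). \<forall>i\<in>I. enat_points c'' (B i) = m i}
        = emeasure (thinning M p c') {c''\<in>space (thinning M p c'). \<forall>i\<in>I. enat_points c'' (B i) = m i}"
    proof (rule laplace_unique[OF I])
      show "finite_measure (thinning M p c)" "finite_measure (thinning M p c')"
        using c by (auto intro!: prob_space.finite_measure prob_space_thinning)
      fix t :: "'a set set \<Rightarrow> ennreal"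
      have "(\<integral>\<^sup>+c''. nexp (\<Sum>i\<in>I. t i * num_points c'' (B i)) \<partial>thinning M p c)
          = (\<integral>\<^sup>+c''. nexp (\<Sum>i\<in>I. t i * num_points c'' (B i)) \<partial>thinning M p c')"
        using thinning_laplace[OF p c(1) I B, of "\<lambda>i. s (t i)" t] thinning_laplace[OF p c(2) I B, of "\<lambda>i. s (t i)" t]
        by (simp add: s num)
      then show "(\<integral>\<^sup>+c''. nexp (\<Sum>i\<in>I. t i * ennreal_of_enat (enat_points c'' (B i))) \<partial>thinning M p c)
          = (\<integral>\<^sup>+c''. nexp (\<Sum>i\<in>I. t i * ennreal_of_enat (enat_points c'' (B i))) \<partial>thinning M p c')"
        by (simp add: num_points_eq)
    qed measurable
    then show ?thesis by (simp add: E_def sets_eq_imp_space_eq[OF sets_thinning])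
  qed
  \<comment> \<open>\<open>\<Phi> k\<close> is the common probability for all collections with counts \<open>k\<close>; its value is irrelevant if there is none.\<close>
  define \<Phi> where "\<Phi> k = emeasure (thinning M p (SOME c. c \<in> collection_set M \<and> X c = k)) E" for k
  have "emeasure (thinning M p c) E = \<Phi> (X c)" if c: "c \<in> collection_set M" for c
  proof -
    have "(SOME c'. c' \<in> collection_set M \<and> X c' = X c) \<in> collection_set M \<and> X (SOME c'. c' \<in> collection_set M \<and> X c' = X c) = X c"
      using c by (intro someI_ex[where P = "\<lambda>c'. c' \<in> collection_set M \<and> X c' = X c"]) auto
    then show ?thesis unfolding \<Phi>_def using c by (intro eq) auto
  qed
  moreover have "(\<lambda>c. \<Phi> (X c)) \<in> borel_measurable (collections M)"
    by (rule measurable_compose[OF X]) simp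
  ultimately show "(\<lambda>c. emeasure (thinning M p c) {c'\<in>collection_set M. \<forall>i\<in>I. enat_points c' (B i) = m i})
      \<in> borel_measurable (collections M)"
    unfolding E_def[symmetric] by (subst measurable_cong[where g = "\<lambda>c. \<Phi> (X c)"]) auto
qed (simp_all add: prob_space_thinning)

text \<open>
  The thinning theorem, from the identity \<open>1 - nexp (s t) = p * (1 - nexp t)\<close>, where \<open>nexp (s t) = p * nexp t + 1 - p\<close>.
\<close>

lemma has_poisson_laplace_thinning:
  assumes p: "0 \<le> p" "p \<le> 1" and P: "has_poisson_laplace M P"
  shows "has_poisson_laplace (scale_measure (ennreal p) M) (P \<bind> thinning M p)"
proof -
  have sets: "sets P = sets (collections M)" and prob: "prob_space P"
    using P by (simp_all add: has_poisson_laplace_def)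
  note space = sets_eq_imp_space_eq[OF sets]
  have coll: "collections (scale_measure (ennreal p) M) = collections M"
    by (rule collections_cong) simp
  have alg: "P \<in> space (prob_algebra (collections M))"
    using sets prob by (simp add: space_prob_algebra)
  have T: "thinning M p \<in> P \<rightarrow>\<^sub>M subprob_algebra (collections M)"
    using measurable_prob_algebraD[OF measurable_thinning[OF p]] measurable_cong_sets[OF sets refl] by blast
  obtain s where s: "\<And>t. nexp (s t) = nexp t * ennreal p + ennreal (1 - p)"
    using thinning_exponent[OF p] by blast
  have s': "1 - nexp (s t) = (1 - nexp t) * ennreal p" for t
  proof -
    obtain r where r: "nexp t = ennreal r" "0 \<le> r" "r \<le> 1"
      using nexp_le_1[of t] nexp_less_top[of t] by (cases "nexp t") (auto simp del: nexp_less_top)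
    have "nexp (s t) = ennreal (r * p + (1 - p))"
      unfolding s r using p r by (simp add: ennreal_mult)
    then have "1 - nexp (s t) = ennreal 1 - ennreal (r * p + (1 - p))"
      by (simp only: ennreal_1)
    also have "\<dots> = ennreal (1 - (r * p + (1 - p)))"
      by (rule ennreal_minus) (use p r in auto)
    also have "1 - (r * p + (1 - p)) = (1 - r) * p" by (simp add: algebra_simps)
    also have "ennreal ((1 - r) * p) = (1 - nexp t) * ennreal p"
      using p r by (simp add: ennreal_mult ennreal_minus flip: ennreal_1)
    finally show ?thesis .
  qed
  show ?thesis
    unfolding has_poisson_laplace_def coll
  proof (intro conjI allI impI)
    show "prob_space (P \<bind> thinning M p)" by (rule prob_space_bind'[OF alg measurable_thinning[OF p]])
    show "sets (P \<bind> thinning M p) = sets (collections M)" by (rule sets_bind'[OF alg measurable_thinning[OF p]])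
    fix n :: nat and B :: "nat \<Rightarrow> 'a set" and t :: "nat \<Rightarrow> ennreal"
    assume "\<forall>i<n. B i \<in> sets (scale_measure (ennreal p) M)" and disj: "disjoint_family_on B {..<n}"
    then have B [measurable]: "i \<in> {..<n} \<Longrightarrow> B i \<in> sets M" for i by simp
    then have B' [measurable]: "i < n \<Longrightarrow> B i \<in> sets M" for i by simp
    have "(\<integral>\<^sup>+c. nexp (\<Sum>i<n. t i * num_points c (B i)) \<partial>(P \<bind> thinning M p))
        = (\<integral>\<^sup>+c. \<integral>\<^sup>+c'. nexp (\<Sum>i<n. t i * num_points c' (B i)) \<partial>thinning M p c \<partial>P)"
      by (rule nn_integral_bind[OF _ T]) measurable
    also have "\<dots> = (\<integral>\<^sup>+c. nexp (\<Sum>i<n. s (t i) * num_points c (B i)) \<partial>P)"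
      by (intro nn_integral_cong thinning_laplace p B disj s) (simp_all add: space)
    also have "\<dots> = nexp (\<Sum>i<n. (1 - nexp (s (t i))) * emeasure M (B i))"
      by (intro has_poisson_laplaceD[OF P] B disj) simp_all
    also have "\<dots> = nexp (\<Sum>i<n. (1 - nexp (t i)) * emeasure (scale_measure (ennreal p) M) (B i))"
      by (simp add: s' mult.assoc)
    finally show "(\<integral>\<^sup>+c. nexp (\<Sum>i<n. t i * num_points c (B i)) \<partial>(P \<bind> thinning M p))
        = nexp (\<Sum>i<n. (1 - nexp (t i)) * emeasure (scale_measure (ennreal p) M) (B i))" .
  qed
qed

section \<open>Countable sums of measures\<close>

lemma nn_integral_count_space_Sigma:
  fixes g :: "'a \<Rightarrow> 'b \<Rightarrow> ennreal"
  shows "(\<integral>\<^sup>+x. \<integral>\<^sup>+y. g x y \<partial>count_space (P x) \<partial>count_space A)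
    = (\<integral>\<^sup>+(x, y). g x y \<partial>count_space (Sigma A P))"
proof -
  have "(\<integral>\<^sup>+x. \<integral>\<^sup>+y. g x y \<partial>count_space (P x) \<partial>count_space A)
      = (\<integral>\<^sup>+x. \<integral>\<^sup>+y. (case (x, y) of (x, y) \<Rightarrow> g x y) * indicator (Sigma A P) (x, y) \<partial>count_space UNIV \<partial>count_space UNIV)"
    by (subst nn_integral_count_space_indicator, simp, subst nn_integral_count_space_indicator, simp,
        subst nn_integral_multc[symmetric])
       (auto intro!: nn_integral_cong split: split_indicator)
  also have "\<dots> = (\<integral>\<^sup>+z. (case z of (x, y) \<Rightarrow> g x y) * indicator (Sigma A P) z \<partial>count_space UNIV)"
    by (rule nn_integral_fst_count_space)
  also have "\<dots> = (\<integral>\<^sup>+(x, y). g x y \<partial>count_space (Sigma A P))"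
    by (subst nn_integral_count_space_indicator[of "Sigma A P"]) (auto intro!: nn_integral_cong)
  finally show ?thesis .
qed

text \<open>
  A set function that is a countable sum of measures is a measure, so \<open>measure_of\<close> returns it unchanged.
\<close>

lemma emeasure_measure_of_sum:
  assumes J: "countable J" and sets: "\<And>j. j \<in> J \<Longrightarrow> sets (F j) = sets N"
    and f: "\<And>A. A \<in> sets N \<Longrightarrow> f A = (\<integral>\<^sup>+j. emeasure (F j) A \<partial>count_space J)"
    and A: "A \<in> sets N"
  shows "emeasure (measure_of (space N) (sets N) f) A = f A"
proof (rule emeasure_measure_of)
  show "sets N \<subseteq> Pow (space N)" by (rule sets.space_closed)
  have sets': "sets (measure_of (space N) (sets N) f) = sets N" by simp
  show "positive (sets (measure_of (space N) (sets N) f)) f"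
    by (simp add: positive_def f)
  show "countably_additive (sets (measure_of (space N) (sets N) f)) f"
    unfolding sets'
  proof (rule countably_additiveI)
    fix X :: "nat \<Rightarrow> 'b set" assume X: "range X \<subseteq> sets N" "disjoint_family X" "(\<Union>i. X i) \<in> sets N"
    then have "(\<Sum>i. f (X i)) = (\<Sum>i. \<integral>\<^sup>+j. emeasure (F j) (X i) \<partial>count_space J)"
      by (intro suminf_cong f) auto
    also have "\<dots> = (\<integral>\<^sup>+j. (\<Sum>i. emeasure (F j) (X i)) \<partial>count_space J)"
      by (subst nn_integral_suminf) auto
    also have "\<dots> = (\<integral>\<^sup>+j. emeasure (F j) (\<Union>i. X i) \<partial>count_space J)"
      using X sets by (intro nn_integral_cong suminf_emeasure) auto
    also have "\<dots> = f (\<Union>i. X i)" using X by (simp add: f)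
    finally show "(\<Sum>i. f (X i)) = f (\<Union>i. X i)" .
  qed
qed (use A in auto)

lemma s_finite_sum_nat:
  assumes s: "\<And>n::nat. s_finite_measure (F n)" and sets: "\<And>n. sets (F n) = sets M"
    and em: "\<And>A. A \<in> sets M \<Longrightarrow> emeasure M A = (\<Sum>n. emeasure (F n) A)"
  shows "s_finite_measure M"
proof -
  have "\<forall>n. \<exists>G :: nat \<Rightarrow> _. \<forall>k. finite_measure (G k) \<and> sets (G k) = sets (F n) \<and>
     (\<forall>A\<in>sets (F n). emeasure (F n) A = (\<Sum>k. emeasure (G k) A))"
    using s unfolding s_finite_measure_def by blast
  then obtain G :: "nat \<Rightarrow> nat \<Rightarrow> _" where G: "\<And>n k. finite_measure (G n k)" "\<And>n k. sets (G n k) = sets M"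
      "\<And>n A. A \<in> sets M \<Longrightarrow> emeasure (F n) A = (\<Sum>k. emeasure (G n k) A)"
    unfolding sets by metis
  have "emeasure M A = (\<Sum>m. emeasure (case prod_decode m of (n, k) \<Rightarrow> G n k) A)" if "A \<in> sets M" for A
  proof -
    have "emeasure M A = (\<integral>\<^sup>+n. \<integral>\<^sup>+k. emeasure (G n k) A \<partial>count_space UNIV \<partial>count_space UNIV)"
      using that by (simp add: em G nn_integral_count_space_nat)
    also have "\<dots> = (\<integral>\<^sup>+z. emeasure (case z of (n, k) \<Rightarrow> G n k) A \<partial>count_space UNIV)"
      by (subst nn_integral_count_space_Sigma) (auto intro!: nn_integral_cong)
    also have "\<dots> = (\<integral>\<^sup>+m. emeasure (case prod_decode m of (n, k) \<Rightarrow> G n k) A \<partial>count_space UNIV)"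
      by (rule nn_integral_bij_count_space[symmetric]) (rule bij_prod_decode)
    finally show ?thesis by (simp add: nn_integral_count_space_nat)
  qed
  with G(1,2) show ?thesis
    unfolding s_finite_measure_def
    by (intro exI[of _ "\<lambda>m. case prod_decode m of (n, k) \<Rightarrow> G n k"]) (auto split: prod.split)
qed

lemma s_finite_null_measure: "s_finite_measure (null_measure M)"
  unfolding s_finite_measure_def
  by (intro exI[of _ "\<lambda>_. null_measure M"]) (auto intro!: finite_measureI)

lemma s_finite_sum:
  assumes J: "countable J" and s: "\<And>j. j \<in> J \<Longrightarrow> s_finite_measure (F j)"
    and sets: "\<And>j. j \<in> J \<Longrightarrow> sets (F j) = sets M"
    and em: "\<And>A. A \<in> sets M \<Longrightarrow> emeasure M A = (\<integral>\<^sup>+j. emeasure (F j) A \<partial>count_space J)"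
  shows "s_finite_measure M"
proof -
  define e where "e = to_nat_on J"
  have e: "bij_betw e J (e ` J)" unfolding e_def using inj_on_to_nat_on[OF J] by (rule inj_on_imp_bij_betw)
  define G where "G n = (if n \<in> e ` J then F (the_inv_into J e n) else null_measure M)" for n
  have Ge: "G (e j) = F j" if "j \<in> J" for j
    using that e by (simp add: G_def bij_betw_def the_inv_into_f_f)
  show ?thesis
  proof (rule s_finite_sum_nat)
    fix n
    show "s_finite_measure (G n)" "sets (G n) = sets M"
      using s sets Ge by (cases "n \<in> e ` J"; auto simp: G_def s_finite_null_measure Ge)+
  next
    fix A assume "A \<in> sets M"
    then have "emeasure M A = (\<integral>\<^sup>+j. emeasure (G (e j)) A \<partial>count_space J)"
      by (subst em, assumption, intro nn_integral_cong) (simp_all add: Ge)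
    also have "\<dots> = (\<integral>\<^sup>+n. emeasure (G n) A \<partial>count_space (e ` J))"
      by (rule nn_integral_bij_count_space[OF e])
    also have "\<dots> = (\<integral>\<^sup>+n. emeasure (G n) A \<partial>count_space UNIV)"
      by (rule nn_integral_count_space_eq) (auto simp: G_def)
    finally show "emeasure M A = (\<Sum>n. emeasure (G n) A)"
      by (simp add: nn_integral_count_space_nat)
  qed
qed

lemma s_finite_distr:
  assumes "sigma_finite_measure R" and f [measurable]: "f \<in> R \<rightarrow>\<^sub>M N"
  shows "s_finite_measure (distr R N f)"
proof -
  interpret sigma_finite_measure R by fact
  obtain A :: "nat \<Rightarrow> _" where A: "range A \<subseteq> sets R" "(\<Union>i. A i) = space R"
      "\<And>i. emeasure R (A i) \<noteq> \<infinity>" "disjoint_family A"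
    using sigma_finite_disjoint by blast
  have [measurable]: "A n \<in> sets R" for n using A by auto
  define G where "G n = distr (density R (indicator (A n))) N f" for n
  have em: "emeasure (G n) X = emeasure R (f -` X \<inter> space R \<inter> A n)" if [measurable]: "X \<in> sets N" for n X
    by (simp add: G_def emeasure_distr emeasure_restricted Int_commute)
  show ?thesis
    unfolding s_finite_measure_def
  proof (intro exI[of _ G] allI conjI ballI)
    fix n
    have "emeasure (G n) (space N) \<le> emeasure R (A n)"
      unfolding em[OF sets.top] by (intro emeasure_mono) auto
    then show "finite_measure (G n)"
      using A(3)[of n] by (intro finite_measureI) (auto simp: G_def top_unique)
    show "sets (G n) = sets (distr R N f)" by (simp add: G_def)
  next
    fix X assume "X \<in> sets (distr R N f)"
    then have X [measurable]: "X \<in> sets N" by simp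
    have "f -` X \<inter> space R = (\<Union>n. f -` X \<inter> space R \<inter> A n)" using A(2) by auto
    then have "emeasure R (f -` X \<inter> space R) = emeasure R (\<Union>n. f -` X \<inter> space R \<inter> A n)" by simp
    also have "\<dots> = (\<Sum>n. emeasure R (f -` X \<inter> space R \<inter> A n))"
      using A(4) by (intro suminf_emeasure[symmetric]) (auto simp: disjoint_family_on_def)
    finally show "emeasure (distr R N f) X = (\<Sum>n. emeasure (G n) X)"
      by (simp add: emeasure_distr em)
  qed
qed

lemma s_finite_scale:
  assumes "s_finite_measure M" "r < \<infinity>"
  shows "s_finite_measure (scale_measure r M)"
proof -
  obtain M' :: "nat \<Rightarrow> 'a measure" where M': "\<And>n. finite_measure (M' n)" "\<And>n. sets (M' n) = sets M"
      "\<And>A. A \<in> sets M \<Longrightarrow> emeasure M A = (\<Sum>n. emeasure (M' n) A)"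
    using assms unfolding s_finite_measure_def by metis
  show ?thesis
    unfolding s_finite_measure_def
  proof (intro exI[of _ "\<lambda>n. scale_measure r (M' n)"] allI conjI ballI)
    fix n
    show "finite_measure (scale_measure r (M' n))"
      using assms(2) finite_measure.emeasure_finite[OF M'(1)]
      by (intro finite_measureI) (auto simp: space_scale_measure ennreal_mult_eq_top_iff less_top)
  qed (simp_all add: M')
qed

section \<open>The contribution of one discrete path to the loop measure\<close>

text \<open>
  Pairs of a duration and jump times with indices \<open>1, \<dots>, k\<close>, with Lebesgue measure and without order constraints.
\<close>

definition time_space :: "nat \<Rightarrow> (real \<times> (nat \<Rightarrow> real)) measure" where
  "time_space k = lborel \<Otimes>\<^sub>M (\<Pi>\<^sub>M j\<in>{1..k}. lborel)"

text \<open>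
  The part of \<open>time_space k\<close> where the duration \<open>t\<close> is positive and the jump times are increasing and lie in \<open>(0, t)\<close>.
\<close>

definition time_domain :: "nat \<Rightarrow> (real \<times> (nat \<Rightarrow> real)) set" where
  "time_domain k = {(t, \<tau>) \<in> space (time_space k). 0 < t \<and> \<tau> \<in> jump_times t k}"

lemma sigma_finite_PiM_lborel: "sigma_finite_measure (\<Pi>\<^sub>M j\<in>{1..k::nat}. lborel :: real measure)"
proof -
  interpret product_sigma_finite "\<lambda>_::nat. lborel :: real measure" ..
  show ?thesis by (rule sigma_finite) simp
qed

lemma sigma_finite_time_space: "sigma_finite_measure (time_space k)"
proof -
  interpret P: sigma_finite_measure "\<Pi>\<^sub>M j\<in>{1..k}. lborel :: real measure"
    by (rule sigma_finite_PiM_lborel)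
  interpret pair_sigma_finite "lborel :: real measure" "\<Pi>\<^sub>M j\<in>{1..k}. lborel :: real measure" ..
  show ?thesis unfolding time_space_def ..
qed

lemma measurable_component_time [measurable]:
  "j \<in> {1..k} \<Longrightarrow> (\<lambda>\<omega>. snd \<omega> j) \<in> borel_measurable (time_space k)"
  unfolding time_space_def by measurable

lemma measurable_fst_time [measurable]: "fst \<in> borel_measurable (time_space k)"
  unfolding time_space_def by measurable

lemma sets_time_domain [measurable]: "time_domain k \<in> sets (time_space k)"
proof -
  have "time_domain k = {\<omega> \<in> space (time_space k). 0 < fst \<omega> \<and>
      (\<forall>i\<in>{1..k}. \<forall>j\<in>{1..k}. i < j \<longrightarrow> snd \<omega> i < snd \<omega> j) \<and> (\<forall>j\<in>{1..k}. 0 < snd \<omega> j \<and> snd \<omega> j < fst \<omega>)}"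
    by (auto simp: time_domain_def jump_times_def strict_mono_on_def)
  also have "\<dots> \<in> sets (time_space k)" by measurable
  finally show ?thesis .
qed

lemma measurable_trajectory:
  fixes x :: "nat \<Rightarrow> 'v::finite"
  shows "(\<lambda>(t, \<tau>). trajectory t k x \<tau>) \<in> time_space k \<rightarrow>\<^sub>M borel \<Otimes>\<^sub>M (\<Pi>\<^sub>M r\<in>UNIV. count_space UNIV)"
proof -
  have "(\<lambda>\<omega> r. if 0 \<le> r \<and> r \<le> fst \<omega> then x (card {j\<in>{1..k}. snd \<omega> j \<le> r}) else undefined)
      \<in> time_space k \<rightarrow>\<^sub>M (\<Pi>\<^sub>M r\<in>UNIV. count_space UNIV)"
  proof (rule measurable_PiM_single')
    fix r :: real
    have [measurable]: "(\<lambda>\<omega>. card {j\<in>{1..k}. snd \<omega> j \<le> r}) \<in> time_space k \<rightarrow>\<^sub>M count_space UNIV"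
    proof (rule measurable_card)
      fix i
      show "{\<omega>\<in>space (time_space k). i \<in> {j\<in>{1..k}. snd \<omega> j \<le> r}} \<in> sets (time_space k)"
        by (cases "i \<in> {1..k}") simp_all
    qed
    \<comment> \<open>At a fixed time \<open>r\<close> the trajectory is a function of the number of jumps up to \<open>r\<close>.\<close>
    show "(\<lambda>\<omega>. if 0 \<le> r \<and> r \<le> fst \<omega> then x (card {j\<in>{1..k}. snd \<omega> j \<le> r}) else undefined)
        \<in> time_space k \<rightarrow>\<^sub>M count_space UNIV"
      by measurable
  qed auto
  then have "(\<lambda>\<omega>. (fst \<omega>, \<lambda>r. if 0 \<le> r \<and> r \<le> fst \<omega> then x (card {j\<in>{1..k}. snd \<omega> j \<le> r}) else undefined))
      \<in> time_space k \<rightarrow>\<^sub>M borel \<Otimes>\<^sub>M (\<Pi>\<^sub>M r\<in>UNIV. count_space UNIV)"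
    by (intro measurable_Pair measurable_fst_time)
  then show ?thesis
    by (rule back_subst[where P = "\<lambda>f. f \<in> _"])
       (auto simp: trajectory_def fun_eq_iff)
qed

lemma trajectory_in_based_loop_set:
  assumes "i \<in> V" "x \<in> closed_paths V i k" "0 < t" "\<tau> \<in> jump_times t k"
  shows "trajectory t k x \<tau> \<in> based_loop_set V"
  using assms unfolding based_loop_set_def by blast

lemma space_based_loops: "space (based_loops V) = based_loop_set V"
  by (auto simp: based_loops_def space_restrict_space space_pair_measure space_PiM)

lemma measurable_trajectory_based_loops:
  fixes x :: "nat \<Rightarrow> 'v::finite"
  assumes "i \<in> V" "x \<in> closed_paths V i k"
  shows "(\<lambda>(t, \<tau>). trajectory t k x \<tau>) \<in> restrict_space (time_space k) (time_domain k) \<rightarrow>\<^sub>M based_loops V"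
  unfolding based_loops_def
  by (intro measurable_restrict_space2 measurable_restrict_space1 measurable_trajectory)
     (auto simp: space_restrict_space time_domain_def intro!: trajectory_in_based_loop_set assms)

text \<open>
  The density of the based loop measure on the loops along the path \<open>x\<close>, with respect to Lebesgue measure for the
  duration \<open>t\<close> and the jump times; the factor \<open>1 / t\<close> is included.
\<close>

definition loop_weight ::
    "('v \<Rightarrow> 'v \<Rightarrow> real) \<Rightarrow> ('v \<Rightarrow> real) \<Rightarrow> nat \<Rightarrow> (nat \<Rightarrow> 'v) \<Rightarrow> real \<times> (nat \<Rightarrow> real) \<Rightarrow> ennreal" where
  "loop_weight q h k x = (\<lambda>(t, \<tau>). ennreal (1 / t) * ennreal (loop_density q h t k x \<tau>))"

lemma measurable_loop_density:
  assumes q: "\<And>i j. (\<lambda>u. q u i j) \<in> borel_measurable N" and h: "\<And>i. (\<lambda>u. h u i) \<in> borel_measurable N"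
  shows "(\<lambda>z. loop_density (q (fst z)) (h (fst z)) (fst (snd z)) k x (snd (snd z))) \<in> borel_measurable (N \<Otimes>\<^sub>M time_space k)"
proof -
  note [measurable] = q h
  have [measurable]: "(\<lambda>z. snd (snd z) j) \<in> borel_measurable (N \<Otimes>\<^sub>M time_space k)" if "j \<in> {1..k}" for j
    using that by (intro measurable_compose[OF measurable_snd measurable_component_time])
  have [measurable]: "(\<lambda>z. fst (snd z)) \<in> borel_measurable (N \<Otimes>\<^sub>M time_space k)"
    by (intro measurable_compose[OF measurable_snd measurable_fst_time])
  have [measurable]: "(\<lambda>z. if j = k then fst (snd z) else snd (snd z) (Suc j)) \<in> borel_measurable (N \<Otimes>\<^sub>M time_space k)"
    if "j \<le> k" for j using that by (cases "j = k") auto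
  have [measurable]: "(\<lambda>z. if j = 0 then 0 else snd (snd z) j) \<in> borel_measurable (N \<Otimes>\<^sub>M time_space k)"
    if "j \<le> k" for j using that by (cases "j = 0") auto
  show ?thesis
    unfolding loop_density_def by measurable
qed

lemma measurable_loop_weight:
  assumes "\<And>i j. (\<lambda>u. q u i j) \<in> borel_measurable N" "\<And>i. (\<lambda>u. h u i) \<in> borel_measurable N"
  shows "(\<lambda>(u, \<omega>). loop_weight (q u) (h u) k x \<omega>) \<in> borel_measurable (N \<Otimes>\<^sub>M time_space k)"
proof -
  have [measurable]: "(\<lambda>z. fst (snd z)) \<in> borel_measurable (N \<Otimes>\<^sub>M time_space k)"
    by (intro measurable_compose[OF measurable_snd measurable_fst_time])
  have [measurable]: "(\<lambda>z. loop_density (q (fst z)) (h (fst z)) (fst (snd z)) k x (snd (snd z))) \<in> borel_measurable (N \<Otimes>\<^sub>M time_space k)"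
    by (rule measurable_loop_density[OF assms])
  show ?thesis unfolding loop_weight_def case_prod_beta by measurable
qed

lemma measurable_loop_weight_fixed [measurable]: "loop_weight q h k x \<in> borel_measurable (time_space k)"
  using measurable_compose[OF measurable_Pair1' measurable_loop_weight[of "\<lambda>_. q" "count_space UNIV" "\<lambda>_. h" k x], of "()"]
  by simp

text \<open>
  The part of the based loop measure carried by the loops along the discrete path \<open>x\<close> with \<open>k\<close> jumps.
\<close>

definition loop_part ::
    "'v set \<Rightarrow> ('v \<Rightarrow> 'v \<Rightarrow> real) \<Rightarrow> ('v \<Rightarrow> real) \<Rightarrow> nat \<Rightarrow> (nat \<Rightarrow> 'v) \<Rightarrow> 'v based_loop measure" where
  "loop_part V q h k x = distr (density (restrict_space (time_space k) (time_domain k)) (loop_weight q h k x))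
     (based_loops V) (\<lambda>(t, \<tau>). trajectory t k x \<tau>)"

text \<open>
  The closed discrete paths, each with its starting point and number of jumps.
\<close>

definition loop_index :: "'v set \<Rightarrow> ('v \<times> nat \<times> (nat \<Rightarrow> 'v)) set" where
  "loop_index V = (SIGMA i:V. SIGMA k:UNIV. closed_paths V i k)"

lemma finite_closed_paths: "finite V \<Longrightarrow> finite (closed_paths V i k)"
  unfolding closed_paths_def by (rule finite_subset[of _ "{0..k} \<rightarrow>\<^sub>E V"]) (auto intro: finite_PiE)

lemma countable_loop_index: "finite V \<Longrightarrow> countable (loop_index V)"
  unfolding loop_index_def
  by (intro countable_SIGMA) (auto intro: countable_finite finite_closed_paths)

lemma measurable_trajectory_indicator:
  fixes x :: "nat \<Rightarrow> 'v::finite"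
  assumes ix: "i \<in> V" "x \<in> closed_paths V i k" and A: "A \<in> sets (based_loops V)"
  shows "(\<lambda>\<omega>. indicator A (trajectory (fst \<omega>) k x (snd \<omega>)) * indicator (time_domain k) \<omega> :: ennreal)
    \<in> borel_measurable (time_space k)"
proof -
  have "(\<lambda>\<omega>. indicator A (trajectory (fst \<omega>) k x (snd \<omega>)) :: ennreal) \<in> borel_measurable (restrict_space (time_space k) (time_domain k))"
    using measurable_compose[OF measurable_trajectory_based_loops[OF ix] borel_measurable_indicator[OF A]]
    by (simp add: case_prod_beta)
  then show ?thesis
    by (subst (asm) borel_measurable_restrict_space_iff_ennreal) auto
qed

lemma emeasure_loop_part:
  fixes x :: "nat \<Rightarrow> 'v::finite"
  assumes ix: "i \<in> V" "x \<in> closed_paths V i k" and A: "A \<in> sets (based_loops V)"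
  shows "emeasure (loop_part V q h k x) A
    = (\<integral>\<^sup>+\<omega>. loop_weight q h k x \<omega> * (indicator A (trajectory (fst \<omega>) k x (snd \<omega>)) * indicator (time_domain k) \<omega>) \<partial>time_space k)"
proof -
  note meas = measurable_trajectory_based_loops[OF ix]
  have w: "loop_weight q h k x \<in> borel_measurable (restrict_space (time_space k) (time_domain k))"
    by (rule measurable_restrict_space1) (rule measurable_loop_weight_fixed)
  have "emeasure (loop_part V q h k x) A = (\<integral>\<^sup>+y. indicator A y \<partial>loop_part V q h k x)"
    using A by (simp add: loop_part_def)
  also have "\<dots> = (\<integral>\<^sup>+\<omega>. loop_weight q h k x \<omega> * indicator A (case \<omega> of (t, \<tau>) \<Rightarrow> trajectory t k x \<tau>)
      \<partial>restrict_space (time_space k) (time_domain k))"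
  proof -
    have "(\<integral>\<^sup>+y. indicator A y \<partial>loop_part V q h k x)
        = (\<integral>\<^sup>+\<omega>. indicator A (case \<omega> of (t, \<tau>) \<Rightarrow> trajectory t k x \<tau>)
            \<partial>density (restrict_space (time_space k) (time_domain k)) (loop_weight q h k x))"
      unfolding loop_part_def using meas A by (intro nn_integral_distr) auto
    also have "\<dots> = (\<integral>\<^sup>+\<omega>. loop_weight q h k x \<omega> * indicator A (case \<omega> of (t, \<tau>) \<Rightarrow> trajectory t k x \<tau>)
      \<partial>restrict_space (time_space k) (time_domain k))"
      by (rule nn_integral_density[OF w measurable_compose[OF meas borel_measurable_indicator[OF A]]])
    finally show ?thesis .
  qed
  also have "\<dots> = (\<integral>\<^sup>+\<omega>. loop_weight q h k x \<omega> * (indicator A (trajectory (fst \<omega>) k x (snd \<omega>)) * indicator (time_domain k) \<omega>) \<partial>time_space k)"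
    by (subst nn_integral_restrict_space) (auto intro!: nn_integral_cong simp: case_prod_beta mult.assoc)
  finally show ?thesis .
qed

lemma sigma_finite_loop_part_source:
  "sigma_finite_measure (density (restrict_space (time_space k) (time_domain k)) (loop_weight q h k x))"
proof -
  interpret R: sigma_finite_measure "restrict_space (time_space k) (time_domain k)"
    by (intro sigma_finite_measure_restrict_space sigma_finite_time_space sets_time_domain)
  have "loop_weight q h k x \<in> borel_measurable (restrict_space (time_space k) (time_domain k))"
    by (rule measurable_restrict_space1) (rule measurable_loop_weight_fixed)
  then show ?thesis
    by (subst R.sigma_finite_iff_density_finite) (auto simp: loop_weight_def ennreal_mult_eq_top_iff)
qed

section \<open>The loop measure as a countable sum\<close>

lemma measurable_Pair_time:
  "Pair t \<in> (\<Pi>\<^sub>M j\<in>{1..k}. lborel) \<rightarrow>\<^sub>M time_space k"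
  unfolding time_space_def by measurable

lemma indicator_time_domain:
  assumes "\<tau> \<in> space (\<Pi>\<^sub>M j\<in>{1..k}. lborel)"
  shows "indicator (time_domain k) (t, \<tau>) = (indicator {0<..} t * indicator (jump_times t k) \<tau> :: ennreal)"
  using assms by (auto simp: time_domain_def time_space_def space_pair_measure split: split_indicator)

lemma emeasure_based_loop_measure_at:
  fixes V :: "'v::finite set"
  assumes i: "i \<in> V" and t: "0 < t" and A: "A \<in> sets (based_loops V)"
  shows "emeasure (based_loop_measure_at V q h i t) A
    = (\<integral>\<^sup>+(k, x). (\<integral>\<^sup>+\<tau>\<in>jump_times t k. ennreal (loop_density q h t k x \<tau>) * indicator A (trajectory t k x \<tau>)
        \<partial>(\<Pi>\<^sub>M j\<in>{1..k}. lborel)) \<partial>count_space (SIGMA k:UNIV. closed_paths V i k))"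
proof -
  define S where "S k = (\<Pi>\<^sub>M j\<in>{1..k::nat}. lborel :: real measure)" for k
  define J where "J = (SIGMA k:UNIV. closed_paths V i k)"
  define F where "F = (\<lambda>(k, x). distr (density (restrict_space (S k) (jump_times t k))
      (\<lambda>\<tau>. ennreal (loop_density q h t k x \<tau>))) (based_loops V) (trajectory t k x))"
  define f where "f A = (\<Sum>k. \<Sum>x\<in>closed_paths V i k. \<integral>\<^sup>+\<tau>\<in>jump_times t k.
      ennreal (loop_density q h t k x \<tau>) * indicator A (trajectory t k x \<tau>) \<partial>S k)" for A
  have J: "countable J"
    unfolding J_def by (intro countable_SIGMA) (auto intro!: countable_finite finite_closed_paths)
  have jump: "jump_times t k \<inter> space (S k) \<in> sets (S k)" for k
  proof -
    have "jump_times t k \<inter> space (S k) = Pair t -` time_domain k \<inter> space (S k)"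
      using t by (auto simp: S_def time_domain_def time_space_def space_pair_measure)
    also have "\<dots> \<in> sets (S k)"
      unfolding S_def by (rule measurable_sets[OF measurable_Pair_time sets_time_domain])
    finally show ?thesis .
  qed
  have f_eq: "f A = (\<integral>\<^sup>+(k, x). (\<integral>\<^sup>+\<tau>\<in>jump_times t k. ennreal (loop_density q h t k x \<tau>) * indicator A (trajectory t k x \<tau>)
        \<partial>S k) \<partial>count_space J)" for A
    unfolding f_def J_def nn_integral_count_space_Sigma[symmetric]
    by (simp add: nn_integral_count_space_nat nn_integral_count_space_finite finite_closed_paths)
  have em: "emeasure (F (k, x)) A = (\<integral>\<^sup>+\<tau>\<in>jump_times t k. ennreal (loop_density q h t k x \<tau>) * indicator A (trajectory t k x \<tau>) \<partial>S k)"
    if x: "x \<in> closed_paths V i k" and A: "A \<in> sets (based_loops V)" for k x A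
  proof -
    have "(\<lambda>\<tau>. case (t, \<tau>) of (t, \<tau>) \<Rightarrow> trajectory t k x \<tau>) \<in> S k \<rightarrow>\<^sub>M borel \<Otimes>\<^sub>M (\<Pi>\<^sub>M r\<in>UNIV. count_space UNIV)"
      unfolding S_def by (rule measurable_compose[OF measurable_Pair_time measurable_trajectory])
    then have meas: "trajectory t k x \<in> restrict_space (S k) (jump_times t k) \<rightarrow>\<^sub>M based_loops V"
      unfolding based_loops_def using t
      by (intro measurable_restrict_space2 measurable_restrict_space1)
         (auto simp: space_restrict_space intro!: trajectory_in_based_loop_set[OF i x])
    have "(\<lambda>\<tau>. loop_density q h t k x \<tau>) \<in> borel_measurable (S k)"
      using measurable_compose[OF measurable_compose[OF measurable_Pair_time measurable_Pair1'] measurable_loop_density[of "\<lambda>_. q" "count_space UNIV" "\<lambda>_. h" k x], of "()" t]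
      by (simp add: S_def)
    then have d: "(\<lambda>\<tau>. ennreal (loop_density q h t k x \<tau>)) \<in> borel_measurable (restrict_space (S k) (jump_times t k))"
      by (intro measurable_restrict_space1) simp
    have "emeasure (F (k, x)) A = (\<integral>\<^sup>+l. indicator A l \<partial>F (k, x))"
      using A by (simp add: F_def)
    also have "\<dots> = (\<integral>\<^sup>+\<tau>. indicator A (trajectory t k x \<tau>)
        \<partial>density (restrict_space (S k) (jump_times t k)) (\<lambda>\<tau>. ennreal (loop_density q h t k x \<tau>)))"
      unfolding F_def prod.case using meas A by (intro nn_integral_distr) auto
    also have "\<dots> = (\<integral>\<^sup>+\<tau>. ennreal (loop_density q h t k x \<tau>) * indicator A (trajectory t k x \<tau>)
        \<partial>restrict_space (S k) (jump_times t k))"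
      by (rule nn_integral_density[OF d measurable_compose[OF meas borel_measurable_indicator[OF A]]])
    also have "\<dots> = (\<integral>\<^sup>+\<tau>\<in>jump_times t k. ennreal (loop_density q h t k x \<tau>) * indicator A (trajectory t k x \<tau>) \<partial>S k)"
      by (rule nn_integral_restrict_space[OF jump])
    finally show ?thesis .
  qed
  have "emeasure (based_loop_measure_at V q h i t) A = f A"
    unfolding based_loop_measure_at_def f_def[abs_def, symmetric, unfolded S_def]
  proof (rule emeasure_measure_of_sum[OF J _ _ A])
    show "sets (F j) = sets (based_loops V)" for j by (simp add: F_def split: prod.split)
    fix A assume "A \<in> sets (based_loops V)"
    then show "f A = (\<integral>\<^sup>+j. emeasure (F j) A \<partial>count_space J)"
      unfolding f_eq by (intro nn_integral_cong) (auto simp: J_def em)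
  qed
  then show ?thesis by (simp add: f_eq J_def S_def)
qed

lemma emeasure_loop_part_fst:
  fixes V :: "'v::finite set" and q :: "'v \<Rightarrow> 'v \<Rightarrow> real" and h :: "'v \<Rightarrow> real"
  assumes ix: "i \<in> V" "x \<in> closed_paths V i k" and A: "A \<in> sets (based_loops V)"
  defines "g \<equiv> \<lambda>t. indicator {0<..} t * (ennreal (1 / t) * (\<integral>\<^sup>+\<tau>\<in>jump_times t k.
      ennreal (loop_density q h t k x \<tau>) * indicator A (trajectory t k x \<tau>) \<partial>(\<Pi>\<^sub>M j\<in>{1..k}. lborel)))"
  shows "g \<in> borel_measurable lborel" "emeasure (loop_part V q h k x) A = (\<integral>\<^sup>+t. g t \<partial>lborel)"
proof -
  define S where "S = (\<Pi>\<^sub>M j\<in>{1..k::nat}. lborel :: real measure)"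
  define f where "f \<omega> = loop_weight q h k x \<omega> * (indicator A (trajectory (fst \<omega>) k x (snd \<omega>)) * indicator (time_domain k) \<omega>)" for \<omega>
  have f: "f \<in> borel_measurable (lborel \<Otimes>\<^sub>M S)"
    unfolding f_def S_def time_space_def[symmetric]
    by (intro borel_measurable_times_ennreal measurable_loop_weight_fixed measurable_trajectory_indicator[OF ix A])
  interpret S: sigma_finite_measure S unfolding S_def by (rule sigma_finite_PiM_lborel)
  have g: "g t = (\<integral>\<^sup>+\<tau>. f (t, \<tau>) \<partial>S)" for t
  proof (cases "0 < t")
    case False
    then have "(\<integral>\<^sup>+\<tau>. f (t, \<tau>) \<partial>S) = (\<integral>\<^sup>+\<tau>. 0 \<partial>S)"
      by (intro nn_integral_cong) (simp add: f_def S_def indicator_time_domain)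
    with False show ?thesis by (simp add: g_def)
  next
    case True
    have dens: "(\<lambda>\<tau>. ennreal (loop_density q h t k x \<tau>)) \<in> borel_measurable S"
      using measurable_compose[OF measurable_compose[OF measurable_Pair_time measurable_Pair1'] measurable_loop_density[of "\<lambda>_. q" "count_space UNIV" "\<lambda>_. h" k x], of "()" t]
      by (simp add: S_def)
    have ind: "(\<lambda>\<tau>. indicator A (trajectory t k x \<tau>) * indicator (time_domain k) (t, \<tau>) :: ennreal) \<in> borel_measurable S"
      using measurable_compose[OF measurable_Pair_time measurable_trajectory_indicator[OF ix A], of t]
      by (simp add: S_def)
    have "(\<integral>\<^sup>+\<tau>. f (t, \<tau>) \<partial>S) = (\<integral>\<^sup>+\<tau>. ennreal (1 / t) * (ennreal (loop_density q h t k x \<tau>) *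
        (indicator A (trajectory t k x \<tau>) * indicator (time_domain k) (t, \<tau>))) \<partial>S)"
      by (simp add: f_def loop_weight_def mult.assoc)
    also have "\<dots> = ennreal (1 / t) * (\<integral>\<^sup>+\<tau>. ennreal (loop_density q h t k x \<tau>) *
        (indicator A (trajectory t k x \<tau>) * indicator (time_domain k) (t, \<tau>)) \<partial>S)"
      by (intro nn_integral_cmult borel_measurable_times_ennreal dens ind)
    also have "\<dots> = g t"
    proof -
      have "(\<integral>\<^sup>+\<tau>. ennreal (loop_density q h t k x \<tau>) *
          (indicator A (trajectory t k x \<tau>) * indicator (time_domain k) (t, \<tau>)) \<partial>S)
        = (\<integral>\<^sup>+\<tau>\<in>jump_times t k. ennreal (loop_density q h t k x \<tau>) * indicator A (trajectory t k x \<tau>) \<partial>S)"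
        using True by (intro nn_integral_cong) (simp add: indicator_time_domain[of _ k t, folded S_def] mult.assoc)
      then show ?thesis using True by (simp add: g_def S_def)
    qed
    finally show ?thesis ..
  qed
  show "g \<in> borel_measurable lborel"
    unfolding g using f by (rule S.borel_measurable_nn_integral_fst)
  have "emeasure (loop_part V q h k x) A = (\<integral>\<^sup>+\<omega>. f \<omega> \<partial>(lborel \<Otimes>\<^sub>M S))"
    unfolding f_def S_def time_space_def[symmetric] by (rule emeasure_loop_part[OF ix A])
  also have "\<dots> = (\<integral>\<^sup>+t. g t \<partial>lborel)"
    unfolding g by (rule S.nn_integral_fst[OF f, symmetric])
  finally show "emeasure (loop_part V q h k x) A = (\<integral>\<^sup>+t. g t \<partial>lborel)" .
qed

text \<open>
  The based loop measure is the sum of its parts over the countably many discrete paths: the sums and the integral over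
  the duration are exchanged. Thus its image under the quotient map is s-finite, and its dependence on the rates is measurable.
\<close>

lemma emeasure_based_loop_measure:
  fixes V :: "'v::finite set"
  assumes A: "A \<in> sets (based_loops V)"
  shows "emeasure (based_loop_measure V q h) A
    = (\<integral>\<^sup>+(i, k, x). emeasure (loop_part V q h k x) A \<partial>count_space (loop_index V))"
proof -
  define f where "f A = (\<Sum>i\<in>V. \<integral>\<^sup>+t\<in>{0<..}. ennreal (1 / t) * emeasure (based_loop_measure_at V q h i t) A \<partial>lborel)" for A
  have f_eq: "f A = (\<integral>\<^sup>+j. emeasure (case j of (i, k, x) \<Rightarrow> loop_part V q h k x) A \<partial>count_space (loop_index V))"
    if A: "A \<in> sets (based_loops V)" for A
  proof -
    define g where "g = (\<lambda>(k, x) t. indicator {0<..} t * (ennreal (1 / t) * (\<integral>\<^sup>+\<tau>\<in>jump_times t k.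
      ennreal (loop_density q h t k x \<tau>) * indicator A (trajectory t k x \<tau>) \<partial>(\<Pi>\<^sub>M j\<in>{1..k}. lborel))))"
    have "(\<integral>\<^sup>+t\<in>{0<..}. ennreal (1 / t) * emeasure (based_loop_measure_at V q h i t) A \<partial>lborel)
        = (\<integral>\<^sup>+y. emeasure (case y of (k, x) \<Rightarrow> loop_part V q h k x) A \<partial>count_space (SIGMA k:UNIV. closed_paths V i k))"
      if i: "i \<in> V" for i
    proof -
      have J: "countable (SIGMA k:UNIV. closed_paths V i k)"
        by (intro countable_SIGMA) (auto intro!: countable_finite finite_closed_paths)
      have "(\<integral>\<^sup>+t\<in>{0<..}. ennreal (1 / t) * emeasure (based_loop_measure_at V q h i t) A \<partial>lborel)
          = (\<integral>\<^sup>+t. \<integral>\<^sup>+y. g y t \<partial>count_space (SIGMA k:UNIV. closed_paths V i k) \<partial>lborel)"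
      proof (rule nn_integral_cong)
        fix t :: real
        show "ennreal (1 / t) * emeasure (based_loop_measure_at V q h i t) A * indicator {0<..} t
            = (\<integral>\<^sup>+y. g y t \<partial>count_space (SIGMA k:UNIV. closed_paths V i k))"
          by (cases "0 < t") (simp_all add: emeasure_based_loop_measure_at[OF i _ A] g_def split_def nn_integral_cmult)
      qed
      also have "\<dots> = (\<integral>\<^sup>+y. \<integral>\<^sup>+t. g y t \<partial>lborel \<partial>count_space (SIGMA k:UNIV. closed_paths V i k))"
        using emeasure_loop_part_fst(1)[OF i _ A]
        by (intro nn_integral_count_space_nn_integral[OF J]) (auto simp: g_def)
      also have "\<dots> = (\<integral>\<^sup>+y. emeasure (case y of (k, x) \<Rightarrow> loop_part V q h k x) A \<partial>count_space (SIGMA k:UNIV. closed_paths V i k))"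
        using emeasure_loop_part_fst(2)[OF i _ A]
        by (intro nn_integral_cong) (auto simp: g_def)
      finally show ?thesis .
    qed
    then have "f A = (\<integral>\<^sup>+i. \<integral>\<^sup>+y. emeasure (case y of (k, x) \<Rightarrow> loop_part V q h k x) A
        \<partial>count_space (SIGMA k:UNIV. closed_paths V i k) \<partial>count_space V)"
      by (simp add: f_def nn_integral_count_space_finite)
    also have "\<dots> = (\<integral>\<^sup>+j. emeasure (case j of (i, k, x) \<Rightarrow> loop_part V q h k x) A \<partial>count_space (loop_index V))"
      unfolding nn_integral_count_space_Sigma loop_index_def by (simp add: split_def)
    finally show ?thesis .
  qed
  have "emeasure (based_loop_measure V q h) A = f A"
    unfolding based_loop_measure_def f_def[abs_def, symmetric]
    by (rule emeasure_measure_of_sum[OF countable_loop_index _ f_eq A])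
       (auto simp: loop_part_def split: prod.split)
  then show ?thesis by (simp add: f_eq[OF A] split_def)
qed

lemma sets_based_loop_measure [simp]: "sets (based_loop_measure V q h) = sets (based_loops V)"
  by (simp add: based_loop_measure_def)

lemma measurable_loop_of: "loop_of V \<in> based_loops V \<rightarrow>\<^sub>M loops V"
  unfolding loops_def
  by (rule measurable_measure_of)
     (auto simp: space_based_loops loop_of_def quotient_def)

lemma sets_loop_measure [simp]: "sets (loop_measure V q h) = sets (loops V)"
  by (simp add: loop_measure_def)

lemma emeasure_loop_measure:
  fixes V :: "'v::finite set"
  assumes A: "A \<in> sets (loops V)"
  shows "emeasure (loop_measure V q h) A = (\<integral>\<^sup>+(i, k, x). emeasure (loop_part V q h k x) (loop_of V -` A \<inter> based_loop_set V)
      \<partial>count_space (loop_index V))"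
proof -
  have "loop_of V \<in> based_loop_measure V q h \<rightarrow>\<^sub>M loops V"
    using measurable_loop_of measurable_cong_sets[OF sets_based_loop_measure refl] by blast
  moreover have "space (based_loop_measure V q h) = based_loop_set V"
    using sets_eq_imp_space_eq[OF sets_based_loop_measure] by (simp add: space_based_loops)
  ultimately show ?thesis
    using A measurable_sets[OF measurable_loop_of A]
    by (simp add: loop_measure_def emeasure_distr emeasure_based_loop_measure space_based_loops)
qed

lemma s_finite_loop_measure:
  fixes V :: "'v::finite set"
  shows "s_finite_measure (loop_measure V q h)"
proof (rule s_finite_sum[OF countable_loop_index])
  fix j assume "j \<in> loop_index V"
  then obtain i k x where j: "j = (i, k, x)" "i \<in> V" "x \<in> closed_paths V i k"
    by (auto simp: loop_index_def)
  define R where "R = density (restrict_space (time_space k) (time_domain k)) (loop_weight q h k x)"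
  have "(\<lambda>(t, \<tau>). trajectory t k x \<tau>) \<in> R \<rightarrow>\<^sub>M based_loops V"
    using measurable_trajectory_based_loops[OF j(2,3)] by (simp add: R_def)
  then have "distr (loop_part V q h k x) (loops V) (loop_of V) = distr R (loops V) (loop_of V \<circ> (\<lambda>(t, \<tau>). trajectory t k x \<tau>))"
      "loop_of V \<circ> (\<lambda>(t, \<tau>). trajectory t k x \<tau>) \<in> R \<rightarrow>\<^sub>M loops V"
    unfolding loop_part_def R_def[symmetric] using measurable_loop_of
    by (auto intro: distr_distr measurable_comp)
  moreover have "sigma_finite_measure R"
    unfolding R_def by (rule sigma_finite_loop_part_source)
  ultimately show "s_finite_measure (case j of (i, k, x) \<Rightarrow> distr (loop_part V q h k x) (loops V) (loop_of V))"
    using j s_finite_distr by simp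
  show "sets (case j of (i, k, x) \<Rightarrow> distr (loop_part V q h k x) (loops V) (loop_of V)) = sets (loop_measure V q h)"
    by (simp add: j)
next
  fix A assume "A \<in> sets (loop_measure V q h)"
  then have A: "A \<in> sets (loops V)" by simp
  have "loop_of V \<in> loop_part V q h k x \<rightarrow>\<^sub>M loops V" for k x
    using measurable_loop_of by (simp add: loop_part_def)
  moreover have "space (loop_part V q h k x) = based_loop_set V" for k x
    by (simp add: loop_part_def space_based_loops)
  ultimately have "emeasure (distr (loop_part V q h k x) (loops V) (loop_of V)) A
      = emeasure (loop_part V q h k x) (loop_of V -` A \<inter> based_loop_set V)" for k x
    using A by (simp add: emeasure_distr)
  then show "emeasure (loop_measure V q h) A
      = (\<integral>\<^sup>+j. emeasure (case j of (i, k, x) \<Rightarrow> distr (loop_part V q h k x) (loops V) (loop_of V)) A \<partial>count_space (loop_index V))"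
    by (subst emeasure_loop_measure[OF A]) (auto intro!: nn_integral_cong)
qed simp

lemma measurable_emeasure_loop_measure:
  fixes V :: "'v::finite set"
  assumes q: "\<And>i j. (\<lambda>u. q u i j) \<in> borel_measurable N" and h: "\<And>i. (\<lambda>u. h u i) \<in> borel_measurable N"
    and A: "A \<in> sets (loops V)"
  shows "(\<lambda>u. emeasure (loop_measure V (q u) (h u)) A) \<in> borel_measurable N"
proof -
  have A': "loop_of V -` A \<inter> based_loop_set V \<in> sets (based_loops V)"
    using measurable_sets[OF measurable_loop_of A] by (simp add: space_based_loops)
  have "(\<lambda>u. emeasure (loop_part V (q u) (h u) k x) (loop_of V -` A \<inter> based_loop_set V)) \<in> borel_measurable N"
    if ix: "i \<in> V" "x \<in> closed_paths V i k" for i k x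
  proof -
    interpret sigma_finite_measure "time_space k" by (rule sigma_finite_time_space)
    have [measurable]: "(\<lambda>z. loop_weight (q (fst z)) (h (fst z)) k x (snd z)) \<in> borel_measurable (N \<Otimes>\<^sub>M time_space k)"
      using measurable_loop_weight[of q N h k x, OF q h] by (simp add: case_prod_beta)
    have [measurable]: "(\<lambda>\<omega>. indicator (loop_of V -` A \<inter> based_loop_set V) (trajectory (fst \<omega>) k x (snd \<omega>)) * indicator (time_domain k) \<omega> :: ennreal)
      \<in> borel_measurable (time_space k)"
      by (rule measurable_trajectory_indicator[OF ix A'])
    show ?thesis
      unfolding emeasure_loop_part[OF ix A']
      by (rule borel_measurable_nn_integral) (simp add: case_prod_beta, measurable)
  qed
  then show ?thesis
    unfolding emeasure_loop_measure[OF A] case_prod_beta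
    by (intro borel_measurable_nn_integral_count_space countable_loop_index) (auto simp: loop_index_def)
qed

section \<open>Measurability of the quenched loop soup and the annealed identity\<close>

lemma sets_mixing_measure: "sets (mixing_measure W \<delta>) = sets (\<Pi>\<^sub>M i\<in>UNIV. borel)"
  unfolding mixing_measure_def sets_density by (rule sets_PiM_cong) auto

lemma measurable_component_mixing_measure [measurable]:
  "(\<lambda>u. u i) \<in> borel_measurable (mixing_measure W \<delta>)"
  unfolding measurable_cong_sets[OF sets_mixing_measure refl] by measurable

lemma measurable_poisson_process_law:
  assumes s: "\<And>u. u \<in> space N \<Longrightarrow> s_finite_measure (L u)" and sets: "\<And>u. u \<in> space N \<Longrightarrow> sets (L u) = sets M"
    and L: "\<And>A. A \<in> sets M \<Longrightarrow> (\<lambda>u. emeasure (L u) A) \<in> borel_measurable N"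
  shows "(\<lambda>u. poisson_process_law (L u)) \<in> N \<rightarrow>\<^sub>M prob_algebra (collections M)"
proof (rule measurable_collections_kernel)
  note P = has_poisson_laplace_poisson_process_law[OF s]
  show "prob_space (poisson_process_law (L u))" if "u \<in> space N" for u
    using P[OF that] by (simp add: has_poisson_laplace_def)
  show "sets (poisson_process_law (L u)) = sets (collections M)" if "u \<in> space N" for u
    using P[OF that] collections_cong[OF sets[OF that]] by (simp add: has_poisson_laplace_def)
  fix I :: "'b set set set" and B :: "'b set set \<Rightarrow> 'b set" and m
  assume I: "finite I" and B: "\<And>i. i \<in> I \<Longrightarrow> B i \<in> sets M" "disjoint_family_on B I"
  have "emeasure (poisson_process_law (L u)) {c \<in> collection_set M. \<forall>i\<in>I. enat_points c (B i) = m i}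
      = (\<Prod>i\<in>I. poisson_weight (emeasure (L u) (B i)) (m i))" if u: "u \<in> space N" for u
  proof -
    have "collection_set (L u) = collection_set M"
      using sets_eq_imp_space_eq[OF sets[OF u]] by (simp add: collection_set_def)
    then show ?thesis
      using is_poisson_process_law_joint_counts[OF has_poisson_laplace_imp_is_poisson[OF P[OF u]] I, of B m] B sets[OF u]
      by simp
  qed
  moreover have "(\<lambda>u. \<Prod>i\<in>I. poisson_weight (emeasure (L u) (B i)) (m i)) \<in> borel_measurable N"
    by (intro borel_measurable_prod_ennreal measurable_compose[OF L measurable_poisson_weight] B)
  ultimately show "(\<lambda>u. emeasure (poisson_process_law (L u)) {c \<in> collection_set M. \<forall>i\<in>I. enat_points c (B i) = m i}) \<in> borel_measurable N"
    by (subst measurable_cong) auto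
qed

lemma s_finite_loop_soup_intensity:
  fixes V :: "'v::finite set"
  shows "s_finite_measure (scale_measure (ennreal \<alpha>) (loop_measure V q h))"
  by (intro s_finite_scale s_finite_loop_measure) simp

lemma measurable_loop_soup:
  "loop_soup W \<delta> \<alpha> \<in> mixing_measure W \<delta> \<rightarrow>\<^sub>M prob_algebra (collections (loops (-{\<delta>})))"
  unfolding loop_soup_def
proof (rule measurable_poisson_process_law)
  fix A assume A: "A \<in> sets (loops (-{\<delta>}))"
  have "(\<lambda>u. emeasure (loop_measure (-{\<delta>}) (\<lambda>i j. 1/2 * W i j * exp (u j - u i))
      (\<lambda>i. \<Sum>k\<in>UNIV. 1/2 * W i k * exp (u k - u i))) A) \<in> borel_measurable (mixing_measure W \<delta>)"
    by (rule measurable_emeasure_loop_measure[OF _ _ A]) measurable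
  then show "(\<lambda>u. emeasure (scale_measure (ennreal \<alpha>) (loop_measure (-{\<delta>}) (\<lambda>i j. 1/2 * W i j * exp (u j - u i))
      (\<lambda>i. \<Sum>k\<in>UNIV. 1/2 * W i k * exp (u k - u i)))) A) \<in> borel_measurable (mixing_measure W \<delta>)"
    by simp
qed (simp_all add: s_finite_loop_soup_intensity)

lemma thinning_cong: "sets M = sets N \<Longrightarrow> thinning M p = thinning N p"
  by (simp add: thinning_def fun_eq_iff collections_cong[of M N])

lemma thinning_poisson_process_law:
  assumes "s_finite_measure M" "0 \<le> p" "p \<le> 1"
  shows "poisson_process_law M \<bind> thinning M p = poisson_process_law (scale_measure (ennreal p) M)"
  using has_poisson_laplace_thinning[OF assms(2,3) has_poisson_laplace_poisson_process_law[OF assms(1)]]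
  by (rule poisson_process_law_eqI[symmetric])

lemma scale_measure_scale_measure: "scale_measure r (scale_measure s M) = scale_measure (r * s) M"
  by (rule measure_eqI) (simp_all add: mult.assoc)

theorem lemma21:
  fixes W :: "'v::finite \<Rightarrow> 'v \<Rightarrow> real" and \<delta> :: 'v and \<alpha> :: real
  assumes "\<And>i j. W i j = W j i"
    and "\<And>i j. 0 \<le> W i j"
    and "\<And>i. W i i = 0"
    and "connects (edges W)"
    and "0 < \<alpha>" and "\<alpha> < 1"
  shows "reinforced_loop_soup W \<delta> 1 \<bind> thinning (loops (-{\<delta>})) \<alpha>
         = mixing_measure W \<delta> \<bind> loop_soup W \<delta> \<alpha>"
proof -
  have \<alpha>: "0 \<le> \<alpha>" "\<alpha> \<le> 1" using assms by simp_all
  have quenched: "loop_soup W \<delta> 1 u \<bind> thinning (loops (-{\<delta>})) \<alpha> = loop_soup W \<delta> \<alpha> u" for u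
  proof -
    let ?L = "loop_measure (-{\<delta>}) (\<lambda>i j. 1/2 * W i j * exp (u j - u i)) (\<lambda>i. \<Sum>k\<in>UNIV. 1/2 * W i k * exp (u k - u i))"
    let ?M = "scale_measure (ennreal 1) ?L"
    \<comment> \<open>A thinning depends on the measure only through its sigma-algebra.\<close>
    have "thinning (loops (-{\<delta>})) \<alpha> = thinning ?M \<alpha>" by (rule thinning_cong) simp
    then have "loop_soup W \<delta> 1 u \<bind> thinning (loops (-{\<delta>})) \<alpha> = poisson_process_law ?M \<bind> thinning ?M \<alpha>"
      by (simp only: loop_soup_def)
    also have "\<dots> = poisson_process_law (scale_measure (ennreal \<alpha>) ?M)"
      by (rule thinning_poisson_process_law[OF s_finite_loop_soup_intensity \<alpha>])
    also have "\<dots> = loop_soup W \<delta> \<alpha> u"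
      by (simp only: loop_soup_def scale_measure_scale_measure ennreal_1 mult_1_right)
    finally show ?thesis .
  qed
  have "reinforced_loop_soup W \<delta> 1 \<bind> thinning (loops (-{\<delta>})) \<alpha>
      = mixing_measure W \<delta> \<bind> (\<lambda>u. loop_soup W \<delta> 1 u \<bind> thinning (loops (-{\<delta>})) \<alpha>)"
    unfolding reinforced_loop_soup_def
    by (rule bind_assoc[OF measurable_prob_algebraD[OF measurable_loop_soup] measurable_prob_algebraD[OF measurable_thinning[OF \<alpha>]]])
  also have "\<dots> = mixing_measure W \<delta> \<bind> loop_soup W \<delta> \<alpha>"
    by (simp only: quenched)
  finally show ?thesis .
qed

end
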